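(* Let $(M^{2m},J,g)$ be a standard Kähler locally symmetric manifold, let $(T^{*}_{1}M,{}^{BS}\hat g)$ be its unit cotangent bundle equipped with the Berger-type deformed Sasaki metric, and let $C=(\gamma(t),\vartheta(t))$ be a geodesic on $(T^{*}_{1}M,{}^{BS}\hat g)$, parametrized by arc length. Put $\xi=\vartheta J$ and $\Gamma=(\gamma(t),\xi(t))$. Then all Frenet curvatures of the projected curve $\gamma=\pi\circ\Gamma$ on $(M,g)$ are constant.
   Context: All objects are smooth. A standard Kähler manifold $(M^{2m},J,g)$ is a $2m$-dimensional manifold with an almost complex structure $J$ ($J^2=-I$) and a Riemannian metric $g$ with $g(JX,JY)=g(X,Y)$ such that $\nabla J=0$, where $\nabla$ is the Levi-Civita connection of $g$. Locally symmetric means that the curvature tensor $R$ satisfies $\nabla R=0$. $\pi$ is the projection to $M$. For a covector $\omega$, $\widetilde\omega$ is the vector with $g(\widetilde\omega,X)=\omega(X)$ for all $X$; $g^{-1}(\omega,\theta)=g(\widetilde\omega,\widetilde\theta)$; $\omega J$ is the covector $(\omega J)(X)=\omega(JX)$. In the coordinates $(x^i,p_i)$ on $T^{*}M$ induced by coordinates $(x^i)$ on $M$, with Christoffel symbols $\Gamma^k_{ij}$ of $g$, the horizontal lift of $X=X^i\partial_{x^i}$ is ${}^{H}X=X^{i}\partial_{x^i}+p_{h}\Gamma^{h}_{ij}X^{j}\partial_{p_i}$ and the vertical lift of $\omega=\omega_idx^i$ is ${}^{V}\omega=\omega_i\partial_{p_i}$. The Berger-type deformed Sasaki metric ${}^{BS}g$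 on $T^{*}M$, with real constant $\delta$, is the Riemannian metric defined at $(x,p)$ by ${}^{BS}g({}^{H}X,{}^{H}Y)=g(X,Y)$, ${}^{BS}g({}^{H}X,{}^{V}\theta)=0$, ${}^{BS}g({}^{V}\omega,{}^{V}\theta)=g^{-1}(\omega,\theta)+\delta^{2}g^{-1}(\omega,pJ)\,g^{-1}(\theta,pJ)$. The unit cotangent bundle is the hypersurface $T^{*}_1M=\{(x,p)\in T^{*}M: g^{-1}(p,p)=1\}$ and ${}^{BS}\hat g$ is the metric induced on it by ${}^{BS}g$. A curve $C=(\gamma(t),\vartheta(t))$ on $T_1^{*}M$ consists of a curve $\gamma$ on $M$ and a covector field $\vartheta$ along $\gamma$ with $g^{-1}(\vartheta,\vartheta)=1$. Frenet curvatures: with $s$ an arc length parameter of $\gamma$ in $(M,g)$ and $\nu_1=\gamma'_s$, the Frenet frame $\nu_1,\nu_2,\dots$ (orthonormal along $\gamma$) and the Frenet curvatures $k_1,k_2,\dots$ are determined by the Frenet formulas $(\nu_1)'_s=k_1\nu_2$, $(\nu_i)'_s=-k_{i-1}\nu_{i-1}+k_i\nu_{i+1}$ for $i\ge 2$ (primes are covariant derivatives along $\gamma$), as far as they are defined. *)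

theory Defs
  imports "HOL-Analysis.Analysis"
begin

section \<open>Smooth maps between Euclidean spaces\<close>

text \<open>Only used with an open domain \<^term>\<open>S\<close>.\<close>

primrec Ck_on :: "nat \<Rightarrow> 'e::euclidean_space set \<Rightarrow> ('e \<Rightarrow> 'f::euclidean_space) \<Rightarrow> bool" where
  "Ck_on 0 S f \<longleftrightarrow> continuous_on S f"
| "Ck_on (Suc k) S f \<longleftrightarrow> (\<forall>x\<in>S. f differentiable (at x)) \<and>
     (\<forall>v. Ck_on k S (\<lambda>x. frechet_derivative f (at x) v))"

definition smooth_on :: "'e::euclidean_space set \<Rightarrow> ('e \<Rightarrow> 'f::euclidean_space) \<Rightarrow> bool" where
  "smooth_on S f \<longleftrightarrow> (\<forall>k. Ck_on k S f)"

section \<open>Riemannian geometry in a coordinate domain\<close>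

text \<open>
  A metric on a coordinate domain is a map \<open>G\<close> with \<open>G y\<close> the inner product on the tangent
  space at \<open>y\<close>. The Christoffel map is \<open>\<Gamma>(u,v)\<^sup>k = \<Gamma>\<^sup>k\<^sub>i\<^sub>j u\<^sup>i v\<^sup>j\<close>, characterized by
  \<open>2 G(\<Gamma>(u,v),w) = \<partial>\<^sub>u G(v,w) + \<partial>\<^sub>v G(u,w) - \<partial>\<^sub>w G(u,v)\<close>, i.e. by
  \<open>2 g\<^sub>k\<^sub>l \<Gamma>\<^sup>k\<^sub>i\<^sub>j = \<partial>\<^sub>i g\<^sub>j\<^sub>l + \<partial>\<^sub>j g\<^sub>i\<^sub>l - \<partial>\<^sub>l g\<^sub>i\<^sub>j\<close>; it represents the Levi-Civita connection:
  \<open>\<nabla>\<^sub>u V = \<partial>\<^sub>u V + \<Gamma>(u,V)\<close>.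
\<close>

type_synonym 'e metric = "'e \<Rightarrow> 'e \<Rightarrow> 'e \<Rightarrow> real"

definition christoffel :: "'e::euclidean_space metric \<Rightarrow> 'e \<Rightarrow> 'e \<Rightarrow> 'e \<Rightarrow> 'e" where
  "christoffel G y u v = (THE c. \<forall>w. 2 * G y c w =
      frechet_derivative (\<lambda>z. G z v w) (at y) u
    + frechet_derivative (\<lambda>z. G z u w) (at y) v
    - frechet_derivative (\<lambda>z. G z u v) (at y) w)"

text \<open>In the next three definitions \<open>u, v, w, a\<close> are constant coordinate vector fields, which
  is enough because the expressions are tensorial.\<close>

definition nabla_endo ::
    "'e::euclidean_space metric \<Rightarrow> ('e \<Rightarrow> 'e \<Rightarrow> 'e) \<Rightarrow> 'e \<Rightarrow> 'e \<Rightarrow> 'e \<Rightarrow> 'e" where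
  "nabla_endo G J y a u =
     frechet_derivative (\<lambda>z. J z u) (at y) a
     + christoffel G y a (J y u) - J y (christoffel G y a u)"

definition curvature :: "'e::euclidean_space metric \<Rightarrow> 'e \<Rightarrow> 'e \<Rightarrow> 'e \<Rightarrow> 'e \<Rightarrow> 'e" where
  "curvature G y u v w =
     frechet_derivative (\<lambda>z. christoffel G z v w) (at y) u
     - frechet_derivative (\<lambda>z. christoffel G z u w) (at y) v
     + christoffel G y u (christoffel G y v w)
     - christoffel G y v (christoffel G y u w)"

definition nabla_curvature ::
    "'e::euclidean_space metric \<Rightarrow> 'e \<Rightarrow> 'e \<Rightarrow> 'e \<Rightarrow> 'e \<Rightarrow> 'e \<Rightarrow> 'e" where
  "nabla_curvature G y a u v w =
     frechet_derivative (\<lambda>z. curvature G z u v w) (at y) a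
     + christoffel G y a (curvature G y u v w)
     - curvature G y (christoffel G y a u) v w
     - curvature G y u (christoffel G y a v) w
     - curvature G y u v (christoffel G y a w)"

text \<open>\<open>has_cov_deriv G x V W t\<close>: the field \<open>V\<close> along the curve \<open>x\<close> has at \<open>t\<close> the covariant
  derivative \<open>W = V' + \<Gamma>(x',V)\<close>.\<close>

definition has_cov_deriv ::
    "'e::euclidean_space metric \<Rightarrow> (real \<Rightarrow> 'e) \<Rightarrow> (real \<Rightarrow> 'e) \<Rightarrow> 'e \<Rightarrow> real \<Rightarrow> bool" where
  "has_cov_deriv G x V W t \<longleftrightarrow>
     (V has_vector_derivative
        (W - christoffel G (x t) (vector_derivative x (at t)) (V t))) (at t)"

section \<open>Geodesics of embedded submanifolds\<close>

definition local_parametrization ::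
    "'f::euclidean_space set \<Rightarrow> 'e::euclidean_space set \<Rightarrow> ('e \<Rightarrow> 'f) \<Rightarrow> bool" where
  "local_parametrization S W \<psi> \<longleftrightarrow>
     open W \<and> smooth_on W \<psi> \<and> (\<forall>w\<in>W. inj (frechet_derivative \<psi> (at w))) \<and>
     openin (top_of_set S) (\<psi> ` W) \<and> (\<exists>h. homeomorphism W (\<psi> ` W) \<psi> h)"

definition induced_metric ::
    "('e::euclidean_space \<Rightarrow> 'f::euclidean_space) \<Rightarrow> 'f metric \<Rightarrow> 'e metric" where
  "induced_metric \<psi> G w u v =
     G (\<psi> w) (frechet_derivative \<psi> (at w) u) (frechet_derivative \<psi> (at w) v)"

text \<open>
  \<open>S\<close> is a submanifold whose dimension is that of \<open>'e\<close>. Near the time \<open>t\<close> the curve \<open>c\<close> in \<open>S\<close>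
  satisfies \<open>\<nabla>\<^bsub>c'\<^esub> c' = 0\<close> for the Levi-Civita connection of the metric induced on \<open>S\<close> by \<open>G\<close>;
  the equation is written in some local coordinate system of \<open>S\<close>, whose choice is
  immaterial.
\<close>

definition geodesic_at ::
    "'e::euclidean_space itself \<Rightarrow> 'f::euclidean_space set \<Rightarrow> 'f metric
      \<Rightarrow> (real \<Rightarrow> 'f) \<Rightarrow> real \<Rightarrow> bool" where
  "geodesic_at (_ :: 'e itself) S G c t \<longleftrightarrow>
     (\<exists>W (\<psi> :: 'e \<Rightarrow> 'f) N z.
        local_parametrization S W \<psi> \<and> open N \<and> t \<in> N \<and> smooth_on N z \<and>
        (\<forall>s\<in>N. z s \<in> W \<and> \<psi> (z s) = c s \<and>
           has_cov_deriv (induced_metric \<psi> G) z (\<lambda>r. vector_derivative z (at r)) 0 s))"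

section \<open>Smooth manifolds, Kaehler manifolds\<close>

text \<open>A chart is a pair of its domain and its coordinate map. Vectors, covectors and tensor fields
  are families of components, one for each chart of the atlas, subject to the classical
  transformation laws.\<close>

type_synonym ('a, 'n) chart = "'a set \<times> ('a \<Rightarrow> real^'n)"

definition transition :: "('a, 'n::finite) chart \<Rightarrow> ('a, 'n) chart \<Rightarrow> real^'n \<Rightarrow> real^'n" where
  "transition c d = snd d \<circ> inv_into (fst c) (snd c)"

definition chart_jacobian ::
    "('a, 'n::finite) chart \<Rightarrow> ('a, 'n) chart \<Rightarrow> 'a \<Rightarrow> real^'n \<Rightarrow> real^'n" where
  "chart_jacobian c d x = frechet_derivative (transition c d) (at (snd c x))"

locale smooth_manifold =
  fixes T :: "'a topology" and A :: "('a, 'n::finite) chart set"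
  assumes hausdorff: "Hausdorff_space T"
    and second_countable: "second_countable T"
    and cover: "(\<Union>c\<in>A. fst c) = topspace T"
    and chart_domain: "c \<in> A \<Longrightarrow> openin T (fst c)"
    and chart_range: "c \<in> A \<Longrightarrow> open (snd c ` fst c)"
    and chart_homeo: "c \<in> A \<Longrightarrow>
      homeomorphic_map (subtopology T (fst c)) (top_of_set (snd c ` fst c)) (snd c)"
    and compatible: "c \<in> A \<Longrightarrow> d \<in> A \<Longrightarrow>
      smooth_on (snd c ` (fst c \<inter> fst d)) (transition c d)"

text \<open>\<open>g c y\<close> is the metric in the chart \<open>c\<close> at the point with coordinates \<open>y\<close>.\<close>

locale riemannian_manifold = smooth_manifold T A
  for T :: "'a topology" and A :: "('a, 'n::finite) chart set" +
  fixes g :: "('a, 'n) chart \<Rightarrow> (real^'n) metric"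
  assumes g_bilinear: "c \<in> A \<Longrightarrow> x \<in> fst c \<Longrightarrow> bilinear (g c (snd c x))"
    and g_sym: "c \<in> A \<Longrightarrow> x \<in> fst c \<Longrightarrow> g c (snd c x) u v = g c (snd c x) v u"
    and g_pos: "c \<in> A \<Longrightarrow> x \<in> fst c \<Longrightarrow> u \<noteq> 0 \<Longrightarrow> g c (snd c x) u u > 0"
    and g_smooth: "c \<in> A \<Longrightarrow> smooth_on (snd c ` fst c) (\<lambda>y. g c y u v)"
    and g_tensor: "c \<in> A \<Longrightarrow> d \<in> A \<Longrightarrow> x \<in> fst c \<Longrightarrow> x \<in> fst d \<Longrightarrow>
      g c (snd c x) u v = g d (snd d x) (chart_jacobian c d x u) (chart_jacobian c d x v)"

locale kaehler_manifold = riemannian_manifold T A g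
  for T :: "'a topology" and A :: "('a, 'n::finite) chart set" and g +
  fixes J :: "('a, 'n) chart \<Rightarrow> real^'n \<Rightarrow> real^'n \<Rightarrow> real^'n"
  assumes J_linear: "c \<in> A \<Longrightarrow> x \<in> fst c \<Longrightarrow> linear (J c (snd c x))"
    and J_smooth: "c \<in> A \<Longrightarrow> smooth_on (snd c ` fst c) (\<lambda>y. J c y u)"
    and J_tensor: "c \<in> A \<Longrightarrow> d \<in> A \<Longrightarrow> x \<in> fst c \<Longrightarrow> x \<in> fst d \<Longrightarrow>
      chart_jacobian c d x (J c (snd c x) u) = J d (snd d x) (chart_jacobian c d x u)"
    and J_square: "c \<in> A \<Longrightarrow> x \<in> fst c \<Longrightarrow> J c (snd c x) (J c (snd c x) u) = - u"
    and J_isometry: "c \<in> A \<Longrightarrow> x \<in> fst c \<Longrightarrow>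
      g c (snd c x) (J c (snd c x) u) (J c (snd c x) v) = g c (snd c x) u v"
    and J_parallel: "c \<in> A \<Longrightarrow> x \<in> fst c \<Longrightarrow> nabla_endo (g c) (J c) (snd c x) a u = 0"

definition locally_symmetric ::
    "('a, 'n::finite) chart set \<Rightarrow> (('a, 'n) chart \<Rightarrow> (real^'n) metric) \<Rightarrow> bool" where
  "locally_symmetric A g \<longleftrightarrow>
     (\<forall>c\<in>A. \<forall>x\<in>fst c. \<forall>a u v w. nabla_curvature (g c) (snd c x) a u v w = 0)"

section \<open>Tangent vectors, covectors, the unit cotangent bundle\<close>

type_synonym ('a, 'n) components = "('a, 'n) chart \<Rightarrow> real^'n"

text \<open>The value \<open>0\<close> at irrelevant charts makes the family of components of a (co)vector unique.\<close>

definition tangent_space :: "('a, 'n::finite) chart set \<Rightarrow> 'a \<Rightarrow> ('a, 'n) components set" where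
  "tangent_space A x = {X. (\<forall>c. \<not> (c \<in> A \<and> x \<in> fst c) \<longrightarrow> X c = 0) \<and>
     (\<forall>c\<in>A. \<forall>d\<in>A. x \<in> fst c \<and> x \<in> fst d \<longrightarrow> X d = chart_jacobian c d x (X c))}"

definition cotangent_space :: "('a, 'n::finite) chart set \<Rightarrow> 'a \<Rightarrow> ('a, 'n) components set" where
  "cotangent_space A x = {\<omega>. (\<forall>c. \<not> (c \<in> A \<and> x \<in> fst c) \<longrightarrow> \<omega> c = 0) \<and>
     (\<forall>c\<in>A. \<forall>d\<in>A. x \<in> fst c \<and> x \<in> fst d \<longrightarrow>
        (\<forall>u. \<omega> c \<bullet> u = \<omega> d \<bullet> chart_jacobian c d x u))}"

text \<open>In a chart, a covector with components \<open>\<omega>\<^sub>i\<close> acts on vectors by \<open>X \<mapsto> \<omega> \<bullet> X\<close>.\<close>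

definition sharp :: "(real^'n) metric \<Rightarrow> real^'n \<Rightarrow> real^'n \<Rightarrow> real^'n" where
  "sharp G y \<omega> = (THE v. \<forall>X. G y v X = \<omega> \<bullet> X)"

definition cometric :: "(real^'n) metric \<Rightarrow> (real^'n) metric" where
  "cometric G y \<omega> \<theta> = G y (sharp G y \<omega>) (sharp G y \<theta>)"

definition cotangent_bundle ::
    "'a topology \<Rightarrow> ('a, 'n::finite) chart set \<Rightarrow> ('a \<times> ('a, 'n) components) set" where
  "cotangent_bundle T A = (SIGMA x:topspace T. cotangent_space A x)"

definition bundle_projection :: "'a \<times> ('a, 'n::finite) components \<Rightarrow> 'a"  ("\<pi>") where
  "\<pi> = fst"

definition unit_cotangent_bundle ::
    "'a topology \<Rightarrow> ('a, 'n::finite) chart set \<Rightarrow> (('a, 'n) chart \<Rightarrow> (real^'n) metric)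
      \<Rightarrow> ('a \<times> ('a, 'n) components) set" where
  "unit_cotangent_bundle T A g = {(x, p) \<in> cotangent_bundle T A.
     \<forall>c\<in>A. x \<in> fst c \<longrightarrow> cometric (g c) (snd c x) (p c) (p c) = 1}"

text \<open>The covector \<open>\<omega>J\<close>: in a chart, \<open>adjoint J \<omega> \<bullet> X = \<omega> \<bullet> J X\<close>.\<close>

definition covector_J ::
    "('a, 'n::finite) chart set \<Rightarrow> (('a, 'n) chart \<Rightarrow> real^'n \<Rightarrow> real^'n \<Rightarrow> real^'n)
      \<Rightarrow> 'a \<Rightarrow> ('a, 'n) components \<Rightarrow> ('a, 'n) components" where
  "covector_J A J x \<omega> =
     (\<lambda>c. if c \<in> A \<and> x \<in> fst c then adjoint (J c (snd c x)) (\<omega> c) else 0)"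

section \<open>The Berger-type deformed Sasaki metric\<close>

text \<open>Everything here is in the coordinates \<open>(x\<^sup>i, p\<^sub>i)\<close> induced on the cotangent bundle by a chart.\<close>

definition bundle_coords ::
    "('a, 'n::finite) chart \<Rightarrow> 'a \<times> ('a, 'n) components \<Rightarrow> (real^'n) \<times> (real^'n)" where
  "bundle_coords c q = (snd c (fst q), snd q c)"

definition horizontal_lift ::
    "(real^'n) metric \<Rightarrow> (real^'n) \<times> (real^'n) \<Rightarrow> real^'n \<Rightarrow> (real^'n) \<times> (real^'n)" where
  "horizontal_lift G = (\<lambda>(y, p) X. (X, \<chi> i. p \<bullet> christoffel G y (axis i 1) X))"

definition vertical_lift :: "real^'n \<Rightarrow> (real^'n) \<times> (real^'n)" where
  "vertical_lift \<omega> = (0, \<omega>)"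

text \<open>The covector \<open>\<omega>\<close> in the decomposition of a tangent vector \<open>Z\<close> of the cotangent bundle as
  the horizontal lift of \<open>fst Z\<close> plus the vertical lift of \<open>\<omega>\<close>.\<close>

definition vertical_part ::
    "(real^'n) metric \<Rightarrow> (real^'n) \<times> (real^'n) \<Rightarrow> (real^'n) \<times> (real^'n) \<Rightarrow> real^'n" where
  "vertical_part G P Z = snd (Z - horizontal_lift G P (fst Z))"

definition bs_metric ::
    "(real^'n) metric \<Rightarrow> (real^'n \<Rightarrow> real^'n \<Rightarrow> real^'n) \<Rightarrow> real
      \<Rightarrow> ((real^'n) \<times> (real^'n)) metric" where
  "bs_metric G J \<delta> P Z Z' =
     (let y = fst P; pJ = adjoint (J y) (snd P);
          \<omega> = vertical_part G P Z; \<theta> = vertical_part G P Z'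
      in G y (fst Z) (fst Z') + cometric G y \<omega> \<theta>
         + \<delta>\<^sup>2 * cometric G y \<omega> pJ * cometric G y \<theta> pJ)"

lemma lift_decomposition:
  "Z = horizontal_lift G P (fst Z) + vertical_lift (vertical_part G P Z)"
  by (cases Z; cases P)
     (simp add: horizontal_lift_def vertical_lift_def vertical_part_def)

text \<open>The three equations defining the metric on lifts.\<close>

context
  fixes G :: "(real^'n) metric" and V and y p :: "real^'n"
  assumes V: "open V" "y \<in> V"
    and bil: "\<And>z. z \<in> V \<Longrightarrow> bilinear (G z)"
    and pos: "\<And>z u. z \<in> V \<Longrightarrow> u \<noteq> 0 \<Longrightarrow> G z u u > 0"
    and smooth: "\<And>u v. smooth_on V (\<lambda>z. G z u v)"
begin

lemma cometric_zero: "cometric G y 0 \<theta> = 0" "cometric G y \<theta> 0 = 0"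
proof -
  have "sharp G y 0 = 0" unfolding sharp_def
  proof (rule the_equality)
    show "\<forall>X. G y 0 X = 0 \<bullet> X"
      using bil[OF V(2)] by (simp add: bilinear_lzero)
  next
    fix v assume "\<forall>X. G y v X = 0 \<bullet> X"
    then have "G y v v = 0" by simp
    then show "v = 0" using pos[OF V(2), of v] by (metis less_irrefl)
  qed
  then show "cometric G y 0 \<theta> = 0" "cometric G y \<theta> 0 = 0"
    using bil[OF V(2)] by (simp_all add: cometric_def bilinear_lzero bilinear_rzero)
qed

lemma christoffel_zero: "christoffel G y u 0 = 0"
proof -
  have D0: "frechet_derivative f (at y) = (\<lambda>_. 0)" if "\<And>z. z \<in> V \<Longrightarrow> f z = 0"
    for f :: "real^'n \<Rightarrow> real"
  proof -
    have "(f has_derivative (\<lambda>_. 0)) (at y)"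
      by (rule has_derivative_transform_within_open[OF _ V, of "\<lambda>_. 0"]) (use that in auto)
    then show ?thesis using frechet_derivative_at by metis
  qed
  have L0: "frechet_derivative (\<lambda>z. G z u w) (at y) 0 = 0" for w
  proof -
    have "Ck_on (Suc 0) V (\<lambda>z. G z u w)" using smooth[of u w] unfolding smooth_on_def by blast
    then have "(\<lambda>z. G z u w) differentiable (at y)" using V(2) by simp
    then show ?thesis by (intro linear_0 linear_frechet_derivative)
  qed
  show ?thesis unfolding christoffel_def
  proof (rule the_equality)
    show "\<forall>w. 2 * G y 0 w = frechet_derivative (\<lambda>z. G z 0 w) (at y) u
        + frechet_derivative (\<lambda>z. G z u w) (at y) 0
        - frechet_derivative (\<lambda>z. G z u 0) (at y) w"
      using bil V(2) L0 by (simp add: D0 bilinear_lzero bilinear_rzero)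
  next
    fix c assume "\<forall>w. 2 * G y c w = frechet_derivative (\<lambda>z. G z 0 w) (at y) u
        + frechet_derivative (\<lambda>z. G z u w) (at y) 0
        - frechet_derivative (\<lambda>z. G z u 0) (at y) w"
    then have "2 * G y c c = 0"
      using bil L0 by (simp add: D0 bilinear_lzero bilinear_rzero)
    then show "c = 0" using pos[OF V(2), of c] by fastforce
  qed
qed

lemma vertical_part_lifts:
  "vertical_part G (y, p) (horizontal_lift G (y, p) X) = 0"
  "vertical_part G (y, p) (vertical_lift \<omega>) = \<omega>"
  by (simp_all add: vertical_part_def horizontal_lift_def vertical_lift_def christoffel_zero
      vec_eq_iff)

lemma bs_metric_lifts:
  "bs_metric G J \<delta> (y, p) (horizontal_lift G (y, p) X) (horizontal_lift G (y, p) Y) = G y X Y"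
  "bs_metric G J \<delta> (y, p) (horizontal_lift G (y, p) X) (vertical_lift \<theta>) = 0"
  "bs_metric G J \<delta> (y, p) (vertical_lift \<omega>) (vertical_lift \<theta>) =
     cometric G y \<omega> \<theta>
     + \<delta>\<^sup>2 * cometric G y \<omega> (adjoint (J y) p) * cometric G y \<theta> (adjoint (J y) p)"
proof -
  have "fst (horizontal_lift G (y, p) X) = X" for X by (simp add: horizontal_lift_def)
  moreover have "fst (vertical_lift \<omega>) = (0 :: real^'n)" for \<omega> by (simp add: vertical_lift_def)
  ultimately show
    "bs_metric G J \<delta> (y, p) (horizontal_lift G (y, p) X) (horizontal_lift G (y, p) Y) = G y X Y"
    "bs_metric G J \<delta> (y, p) (horizontal_lift G (y, p) X) (vertical_lift \<theta>) = 0"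
    "bs_metric G J \<delta> (y, p) (vertical_lift \<omega>) (vertical_lift \<theta>) =
       cometric G y \<omega> \<theta>
       + \<delta>\<^sup>2 * cometric G y \<omega> (adjoint (J y) p) * cometric G y \<theta> (adjoint (J y) p)"
    using bil[OF V(2)]
    by (simp_all add: bs_metric_def Let_def vertical_part_lifts cometric_zero
        bilinear_lzero bilinear_rzero)
qed

end

section \<open>Geodesics of the unit cotangent bundle\<close>

definition unit_cotangent_coords :: "('a, 'n::finite) chart \<Rightarrow> (real^'n) metric
      \<Rightarrow> ((real^'n) \<times> (real^'n)) set" where
  "unit_cotangent_coords c G = {(y, p). y \<in> snd c ` fst c \<and> cometric G y p p = 1}"

definition unit_cotangent_curve ::
    "'a topology \<Rightarrow> ('a, 'n::finite) chart set \<Rightarrow> (('a, 'n) chart \<Rightarrow> (real^'n) metric)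
      \<Rightarrow> real set \<Rightarrow> (real \<Rightarrow> 'a \<times> ('a, 'n) components) \<Rightarrow> bool" where
  "unit_cotangent_curve T A g I C \<longleftrightarrow>
     (\<forall>t\<in>I. C t \<in> unit_cotangent_bundle T A g) \<and>
     continuous_map (top_of_set I) T (\<pi> \<circ> C) \<and>
     (\<forall>c\<in>A. smooth_on {t\<in>I. \<pi> (C t) \<in> fst c} (bundle_coords c \<circ> C))"

text \<open>The type argument fixes the model space of the unit cotangent bundle; its dimension has
  to be \<open>2 * CARD('n) - 1\<close>.\<close>

definition bs_geodesic ::
    "'e::euclidean_space itself \<Rightarrow> 'a topology \<Rightarrow> ('a, 'n::finite) chart set
      \<Rightarrow> (('a, 'n) chart \<Rightarrow> (real^'n) metric)
      \<Rightarrow> (('a, 'n) chart \<Rightarrow> real^'n \<Rightarrow> real^'n \<Rightarrow> real^'n) \<Rightarrow> real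
      \<Rightarrow> real set \<Rightarrow> (real \<Rightarrow> 'a \<times> ('a, 'n) components) \<Rightarrow> bool" where
  "bs_geodesic E T A g J \<delta> I C \<longleftrightarrow>
     unit_cotangent_curve T A g I C \<and>
     (\<forall>t\<in>I. \<forall>c\<in>A. \<pi> (C t) \<in> fst c \<longrightarrow>
        geodesic_at E (unit_cotangent_coords c (g c)) (bs_metric (g c) (J c) \<delta>)
          (bundle_coords c \<circ> C) t)"

definition bs_arc_length_parametrized ::
    "('a, 'n::finite) chart set \<Rightarrow> (('a, 'n) chart \<Rightarrow> (real^'n) metric)
      \<Rightarrow> (('a, 'n) chart \<Rightarrow> real^'n \<Rightarrow> real^'n \<Rightarrow> real^'n) \<Rightarrow> real
      \<Rightarrow> real set \<Rightarrow> (real \<Rightarrow> 'a \<times> ('a, 'n) components) \<Rightarrow> bool" where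
  "bs_arc_length_parametrized A g J \<delta> I C \<longleftrightarrow>
     (\<forall>t\<in>I. \<forall>c\<in>A. \<pi> (C t) \<in> fst c \<longrightarrow>
        (let C' = vector_derivative (bundle_coords c \<circ> C) (at t)
         in bs_metric (g c) (J c) \<delta> (bundle_coords c (C t)) C' C' = 1))"

section \<open>Frenet frames\<close>

text \<open>
  Frenet frame \<open>\<nu>\<^sub>1, ..., \<nu>\<^sub>r\<close> along a regular curve \<open>\<gamma>\<close> on \<open>M\<close>, with its curvatures
  \<open>k\<^sub>1, ..., k\<^bsub>r-1\<^esub>\<close>. With \<open>\<sigma>(t) = |\<gamma>'(t)|\<close>, an arc length parameter \<open>s\<close> satisfies \<open>ds = \<sigma> dt\<close>; so
  the derivative with respect to \<open>s\<close> is the one with respect to \<open>t\<close> divided by \<open>\<sigma>\<close>, and the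
  Frenet formulas are stated multiplied by \<open>\<sigma>\<close>.

  A next frame vector is determined only as long as the curvatures do not vanish. Hence
  \<open>k\<^sub>1, ..., k\<^bsub>r-2\<^esub>\<close> are positive, while the last one, \<open>k\<^bsub>r-1\<^esub>\<close>, is still defined where it is
  zero. It is the norm of \<open>(\<nu>\<^bsub>r-1\<^esub>)'\<^sub>s + k\<^bsub>r-2\<^esub> \<nu>\<^bsub>r-2\<^esub>\<close>, and \<open>\<nu>\<^sub>r\<close> is not required to be differentiable.
\<close>

definition frenet_frame ::
    "('a, 'n::finite) chart set \<Rightarrow> (('a, 'n) chart \<Rightarrow> (real^'n) metric)
      \<Rightarrow> real set \<Rightarrow> (real \<Rightarrow> 'a) \<Rightarrow> nat
      \<Rightarrow> (nat \<Rightarrow> real \<Rightarrow> ('a, 'n) components) \<Rightarrow> (nat \<Rightarrow> real \<Rightarrow> real) \<Rightarrow> bool" where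
  "frenet_frame A g I \<gamma> r \<nu> k \<longleftrightarrow>
     (\<forall>t\<in>I. \<forall>i\<in>{1..r}. \<nu> i t \<in> tangent_space A (\<gamma> t)) \<and>
     (\<forall>t\<in>I. \<forall>i\<in>{1..<r}. k i t \<ge> 0) \<and>
     (\<forall>t\<in>I. \<forall>i\<in>{1..<r-1}. k i t > 0) \<and>
     (\<forall>t\<in>I. \<forall>c\<in>A. \<gamma> t \<in> fst c \<longrightarrow>
        (let x = snd c \<circ> \<gamma>; x' = vector_derivative x (at t); \<sigma> = sqrt (g c (x t) x' x') in
          x' \<noteq> 0 \<and>
          \<nu> 1 t c = x' /\<^sub>R \<sigma> \<and>
          (\<forall>i\<in>{1..r}. \<forall>j\<in>{1..r}. g c (x t) (\<nu> i t c) (\<nu> j t c) = of_bool (i = j)) \<and>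
          (\<forall>i\<in>{1..<r}. has_cov_deriv (g c) x (\<lambda>s. \<nu> i s c)
             (\<sigma> *\<^sub>R ((if i = 1 then 0 else - (k (i - 1) t *\<^sub>R \<nu> (i - 1) t c))
                     + k i t *\<^sub>R \<nu> (i + 1) t c)) t)))"

end

theory Submission
  imports Defs
begin

text \<open>
  Let \<open>u\<close> be the vector field dual to \<open>\<theta>\<close> along \<open>\<gamma>\<close>, \<open>D\<close> the covariant derivative along \<open>\<gamma>\<close> and
  \<open>\<alpha> = g(Du, Ju)\<close>. Identifying covectors with vectors, the energy density becomes
  \<open>|\<gamma>'|\<^sup>2 + |Du|\<^sup>2 + \<delta>\<^sup>2 \<alpha>\<^sup>2\<close> under the constraint \<open>|u| = 1\<close>, and its Euler-Lagrange equations are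
  \<open>\<alpha>' = 0\<close>, \<open>D\<^sup>2u = \<lambda> u - 2 \<delta>\<^sup>2 \<alpha> J Du\<close> and \<open>D\<gamma>' = F \<gamma>'\<close> with the skew-adjoint operator
  \<open>F = R(Du + \<delta>\<^sup>2 \<alpha> Ju, u)\<close>. Since \<open>\<nabla>R = 0\<close> and \<open>R(Ja, b) = - R(a, Jb)\<close>, the operator \<open>F\<close> is
  parallel along \<open>\<gamma>\<close>. So the solutions \<open>E\<close> of \<open>DE = F E\<close> form a real vector space, which is closed
  under \<open>F\<close> and contains \<open>\<gamma>'\<close>, and they have constant length. With \<open>\<sigma> = |\<gamma>'|\<close>, the Frenet formula
  \<open>\<sigma> k\<^sub>i \<nu>\<^bsub>i+1\<^esub> = F \<nu>\<^sub>i + \<sigma> k\<^bsub>i-1\<^esub> \<nu>\<^bsub>i-1\<^esub>\<close> shows by induction that each \<open>\<sigma> k\<^sub>i \<nu>\<^bsub>i+1\<^esub>\<close> is such a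
  solution, and its length is \<open>\<sigma> k\<^sub>i\<close>.
\<close>

section \<open>Calculus of smooth maps\<close>

abbreviation FD :: "('e::euclidean_space \<Rightarrow> 'f::euclidean_space) \<Rightarrow> 'e \<Rightarrow> 'e \<Rightarrow> 'f" where
  "FD f x \<equiv> frechet_derivative f (at x)"

lemma Ck_on_SucD:
  assumes "Ck_on (Suc k) S f"
  shows "x \<in> S \<Longrightarrow> (f has_derivative FD f x) (at x)" "Ck_on k S (\<lambda>x. FD f x v)"
  using assms by (auto simp: frechet_derivative_works)

lemma Ck_on_0_cong:
  assumes "\<And>x. x \<in> S \<Longrightarrow> f x = g x" "Ck_on 0 S f"
  shows "Ck_on 0 S g"
  using assms by (metis Ck_on.simps(1) continuous_on_cong)

lemma FD_cong:
  assumes "open S" "x \<in> S" "\<And>x. x \<in> S \<Longrightarrow> f x = g x" "f differentiable (at x)"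
  shows "g differentiable (at x)" "FD g x = FD f x"
proof -
  have "(g has_derivative FD f x) (at x)"
    using has_derivative_transform_within_open[of f "FD f x" x UNIV S g] assms
    by (simp add: frechet_derivative_works)
  then show "g differentiable (at x)" "FD g x = FD f x"
    using frechet_derivative_at differentiable_def by metis+
qed

lemma Ck_on_cong:
  assumes "open S" "\<And>x. x \<in> S \<Longrightarrow> f x = g x" "Ck_on k S f"
  shows "Ck_on k S g"
  using assms(2,3)
proof (induction k arbitrary: f g)
  case 0
  then show ?case using Ck_on_0_cong by blast
next
  case (Suc k)
  have "g differentiable (at x) \<and> FD g x = FD f x" if "x \<in> S" for x
    using FD_cong[OF assms(1) that Suc.prems(1)] Suc.prems(2) that by auto
  then show ?case using Suc.IH[of "\<lambda>x. FD f x v" "\<lambda>x. FD g x v" for v] Suc.prems(2)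
    by auto
qed

text \<open>Any derivative exhibited on the open set agrees there with
  \<open>frechet_derivative\<close>, and the remaining conditions in \<open>Ck_on\<close> depend
  only on values on that set. All inductions on the order below go through this rule.\<close>

lemma Ck_on_SucI:
  assumes "open S" "\<And>x. x \<in> S \<Longrightarrow> (f has_derivative f' x) (at x)" "\<And>v. Ck_on k S (\<lambda>x. f' x v)"
  shows "Ck_on (Suc k) S f"
proof -
  have "f differentiable (at x) \<and> FD f x = f' x" if "x \<in> S" for x
    using assms(2)[OF that] frechet_derivative_at differentiable_def by metis
  then show ?thesis using Ck_on_cong[OF assms(1) _ assms(3)] by auto
qed

lemma Ck_on_Suc_imp: "open S \<Longrightarrow> Ck_on (Suc k) S f \<Longrightarrow> Ck_on k S f"
proof (induction k arbitrary: f)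
  case 0
  then show ?case
    using continuous_at_imp_continuous_on differentiable_imp_continuous_within by fastforce
next
  case (Suc k)
  then show ?case using Ck_on.simps(2) by blast
qed

lemma Ck_on_const: "open S \<Longrightarrow> Ck_on k S (\<lambda>x. c)"
  by (induction k arbitrary: c) (auto intro!: Ck_on_SucI)

lemma Ck_on_add: "open S \<Longrightarrow> Ck_on k S f \<Longrightarrow> Ck_on k S g \<Longrightarrow> Ck_on k S (\<lambda>x. f x + g x)"
proof (induction k arbitrary: f g)
  case 0
  then show ?case by (simp add: continuous_on_add)
next
  case (Suc k)
  show ?case
    by (rule Ck_on_SucI[OF Suc.prems(1), where f' = "\<lambda>x v. FD f x v + FD g x v"])
      (use Suc.IH Suc.prems Ck_on_SucD in \<open>blast intro: has_derivative_add\<close>)+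
qed

lemma Ck_on_sum:
  assumes "open S"
  shows "finite B \<Longrightarrow> (\<And>b. b \<in> B \<Longrightarrow> Ck_on k S (f b)) \<Longrightarrow> Ck_on k S (\<lambda>x. \<Sum>b\<in>B. f b x)"
  by (induction rule: finite_induct) (auto simp: assms Ck_on_const Ck_on_add)

lemma Ck_on_bounded_linear:
  assumes "bounded_linear h" "open S"
  shows "Ck_on k S f \<Longrightarrow> Ck_on k S (\<lambda>x. h (f x))"
proof (induction k arbitrary: f)
  case 0
  then show ?case using assms by (simp add: bounded_linear.continuous_on)
next
  case (Suc k)
  show ?case
    by (rule Ck_on_SucI[OF assms(2), where f' = "\<lambda>x v. h (FD f x v)"])
      (use Suc Ck_on_SucD in \<open>blast intro: bounded_linear.has_derivative[OF assms(1)]\<close>)+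
qed

lemma Ck_on_bilinear:
  assumes "bounded_bilinear h" "open S"
  shows "Ck_on k S f \<Longrightarrow> Ck_on k S g \<Longrightarrow> Ck_on k S (\<lambda>x. h (f x) (g x))"
proof (induction k arbitrary: f g)
  case 0
  then show ?case using assms by (simp add: bounded_bilinear.continuous_on)
next
  case (Suc k)
  show ?case
  proof (rule Ck_on_SucI[OF assms(2), where f' = "\<lambda>x v. h (f x) (FD g x v) + h (FD f x v) (g x)"])
    show "((\<lambda>x. h (f x) (g x)) has_derivative (\<lambda>v. h (f x) (FD g x v) + h (FD f x v) (g x))) (at x)"
      if "x \<in> S" for x
      by (rule bounded_bilinear.FDERIV[OF assms(1) Ck_on_SucD(1)[OF Suc.prems(1) that]
            Ck_on_SucD(1)[OF Suc.prems(2) that]])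
    show "Ck_on k S (\<lambda>x. h (f x) (FD g x v) + h (FD f x v) (g x))" for v
      by (rule Ck_on_add[OF assms(2)
            Suc.IH[OF Ck_on_Suc_imp[OF assms(2) Suc.prems(1)] Ck_on_SucD(2)[OF Suc.prems(2)]]
            Suc.IH[OF Ck_on_SucD(2)[OF Suc.prems(1)] Ck_on_Suc_imp[OF assms(2) Suc.prems(2)]]])
  qed
qed

lemma Ck_on_compose:
  assumes "open S" "open U"
  shows "Ck_on k U f \<Longrightarrow> Ck_on k S q \<Longrightarrow> q ` S \<subseteq> U \<Longrightarrow> Ck_on k S (\<lambda>x. f (q x))"
proof (induction k arbitrary: f)
  case 0
  then show ?case using continuous_on_compose2 by (metis Ck_on.simps(1))
next
  case (Suc k)
  have lin: "linear (FD f (q x))" if "x \<in> S" for x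
    using Ck_on_SucD(1)[OF Suc.prems(1)] Suc.prems(3) that has_derivative_linear by blast
  \<comment> \<open>The chain rule evaluates \<open>FD f (q x)\<close> in the direction
    \<open>FD q x v\<close>, which moves with \<open>x\<close>, whereas the induction hypothesis
    covers fixed directions. Expanding the moving direction in the basis reduces the claim to
    those.\<close>
  show ?case
  proof (rule Ck_on_SucI[OF assms(1),
        where f' = "\<lambda>x v. \<Sum>b\<in>Basis. (FD q x v \<bullet> b) *\<^sub>R FD f (q x) b"])
    fix x assume x: "x \<in> S"
    have "((\<lambda>x. f (q x)) has_derivative (\<lambda>v. FD f (q x) (FD q x v))) (at x)"
      using has_derivative_compose Ck_on_SucD(1)[OF Suc.prems(1)] Ck_on_SucD(1)[OF Suc.prems(2)]
        Suc.prems(3) x by blast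
    moreover have "FD f (q x) (FD q x v) = (\<Sum>b\<in>Basis. (FD q x v \<bullet> b) *\<^sub>R FD f (q x) b)" for v
      using lin[OF x] by (subst euclidean_representation[symmetric, of "FD q x v"])
        (simp only: linear_sum linear_cmul)
    ultimately show "((\<lambda>x. f (q x)) has_derivative
        (\<lambda>v. \<Sum>b\<in>Basis. (FD q x v \<bullet> b) *\<^sub>R FD f (q x) b)) (at x)" by simp
  next
    fix v
    have "Ck_on k S (\<lambda>x. FD q x v \<bullet> b)" for b
      using Ck_on_bounded_linear[OF bounded_linear_inner_left assms(1)] Ck_on_SucD(2) Suc.prems(2)
      by blast
    moreover have "Ck_on k S (\<lambda>x. FD f (q x) b)" for b
      using Suc.IH Ck_on_SucD(2)[OF Suc.prems(1)] Ck_on_Suc_imp Suc.prems(2,3) assms(1) by blast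
    ultimately show "Ck_on k S (\<lambda>x. \<Sum>b\<in>Basis. (FD q x v \<bullet> b) *\<^sub>R FD f (q x) b)"
      by (intro Ck_on_sum Ck_on_bilinear[OF bounded_bilinear_scaleR]) (use assms in auto)
  qed
qed

text \<open>The derivative of the inverse is a product of \<open>FD f x v\<close> and two copies of
  the inverse itself, so order \<open>k\<close> for the inverse yields order
  \<open>Suc k\<close>.\<close>

lemma Ck_on_inverse:
  fixes f :: "'e::euclidean_space \<Rightarrow> real"
  assumes "open S"
  shows "Ck_on k S f \<Longrightarrow> (\<And>x. x \<in> S \<Longrightarrow> f x \<noteq> 0) \<Longrightarrow> Ck_on k S (\<lambda>x. inverse (f x))"
proof (induction k)
  case 0
  then show ?case by (simp add: continuous_on_inverse)
next
  case (Suc k)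
  show ?case
  proof (rule Ck_on_SucI[OF assms,
        where f' = "\<lambda>x v. - (inverse (f x) * FD f x v * inverse (f x))"])
    show "((\<lambda>x. inverse (f x)) has_derivative (\<lambda>v. - (inverse (f x) * FD f x v * inverse (f x)))) (at x)"
      if "x \<in> S" for x
      by (rule Deriv.has_derivative_inverse[OF Suc.prems(2)[OF that] Ck_on_SucD(1)[OF Suc.prems(1) that]])
    have "Ck_on k S (\<lambda>x. inverse (f x) * FD f x v * inverse (f x))" for v
      by (intro Ck_on_bilinear[OF bounded_bilinear_mult] assms Suc.IH Ck_on_SucD(2)[OF Suc.prems(1)]
          Ck_on_Suc_imp[OF assms Suc.prems(1)] Suc.prems(2))
    then show "Ck_on k S (\<lambda>x. - (inverse (f x) * FD f x v * inverse (f x)))" for v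
      using Ck_on_bounded_linear[OF bounded_linear_minus[OF bounded_linear_ident] assms] by blast
  qed
qed

lemma smooth_on_cong:
  "open S \<Longrightarrow> (\<And>x. x \<in> S \<Longrightarrow> f x = g x) \<Longrightarrow> smooth_on S f \<Longrightarrow> smooth_on S g"
  unfolding smooth_on_def using Ck_on_cong by blast

lemma smooth_on_subset: "smooth_on S f \<Longrightarrow> U \<subseteq> S \<Longrightarrow> smooth_on U f"
proof -
  have "Ck_on k S f \<Longrightarrow> U \<subseteq> S \<Longrightarrow> Ck_on k U f" for k
    by (induction k arbitrary: f) (auto intro: continuous_on_subset)
  then show "smooth_on S f \<Longrightarrow> U \<subseteq> S \<Longrightarrow> smooth_on U f" by (simp add: smooth_on_def)
qed

lemma smooth_on_has_derivative:
  "smooth_on S f \<Longrightarrow> x \<in> S \<Longrightarrow> (f has_derivative FD f x) (at x)"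
  unfolding smooth_on_def using Ck_on_SucD(1) by blast

lemma smooth_on_differentiable: "smooth_on S f \<Longrightarrow> x \<in> S \<Longrightarrow> f differentiable (at x)"
  unfolding differentiable_def using smooth_on_has_derivative by blast

lemma smooth_on_FD: "smooth_on S f \<Longrightarrow> smooth_on S (\<lambda>x. FD f x v)"
  unfolding smooth_on_def using Ck_on_SucD(2) by blast

lemma smooth_on_linear_FD: "smooth_on S f \<Longrightarrow> x \<in> S \<Longrightarrow> linear (FD f x)"
  using smooth_on_has_derivative has_derivative_linear by blast

lemma smooth_on_continuous: "smooth_on S f \<Longrightarrow> continuous_on S f"
  unfolding smooth_on_def using Ck_on.simps(1) by blast

lemma smooth_on_const: "open S \<Longrightarrow> smooth_on S (\<lambda>x. c)"
  by (simp add: smooth_on_def Ck_on_const)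

lemma smooth_on_add: "open S \<Longrightarrow> smooth_on S f \<Longrightarrow> smooth_on S g \<Longrightarrow> smooth_on S (\<lambda>x. f x + g x)"
  by (simp add: smooth_on_def Ck_on_add)

lemma smooth_on_sum: "open S \<Longrightarrow> finite B \<Longrightarrow> (\<And>b. b \<in> B \<Longrightarrow> smooth_on S (f b))
    \<Longrightarrow> smooth_on S (\<lambda>x. \<Sum>b\<in>B. f b x)"
  by (simp add: smooth_on_def Ck_on_sum)

lemma smooth_on_bounded_linear:
  "bounded_linear h \<Longrightarrow> open S \<Longrightarrow> smooth_on S f \<Longrightarrow> smooth_on S (\<lambda>x. h (f x))"
  by (simp add: smooth_on_def Ck_on_bounded_linear)

lemma smooth_on_bilinear:
  "bounded_bilinear h \<Longrightarrow> open S \<Longrightarrow> smooth_on S f \<Longrightarrow> smooth_on S g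
    \<Longrightarrow> smooth_on S (\<lambda>x. h (f x) (g x))"
  by (simp add: smooth_on_def Ck_on_bilinear)

lemma smooth_on_compose:
  "open S \<Longrightarrow> open U \<Longrightarrow> smooth_on U f \<Longrightarrow> smooth_on S q \<Longrightarrow> q ` S \<subseteq> U
    \<Longrightarrow> smooth_on S (\<lambda>x. f (q x))"
  by (simp add: smooth_on_def Ck_on_compose)

lemma smooth_on_inverse:
  fixes f :: "'e::euclidean_space \<Rightarrow> real"
  shows "open S \<Longrightarrow> smooth_on S f \<Longrightarrow> (\<And>x. x \<in> S \<Longrightarrow> f x \<noteq> 0) \<Longrightarrow> smooth_on S (\<lambda>x. inverse (f x))"
  by (simp add: smooth_on_def Ck_on_inverse)

lemma smooth_on_diff:
  assumes "open S" "smooth_on S f" "smooth_on S g"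
  shows "smooth_on S (\<lambda>x. f x - g x)"
  using smooth_on_add[OF assms(1,2)
      smooth_on_bounded_linear[OF bounded_linear_minus[OF bounded_linear_ident] assms(1,3)]]
  by simp

lemma smooth_on_prod:
  fixes f :: "'i \<Rightarrow> 'e::euclidean_space \<Rightarrow> real"
  assumes "open S"
  shows "finite B \<Longrightarrow> (\<And>b. b \<in> B \<Longrightarrow> smooth_on S (f b)) \<Longrightarrow> smooth_on S (\<lambda>x. \<Prod>b\<in>B. f b x)"
  by (induction rule: finite_induct)
    (auto simp: assms smooth_on_const smooth_on_bilinear[OF bounded_bilinear_mult])

section \<open>Smooth families of linear maps and of linear systems\<close>

lemma linear_basis_expansion:
  "linear f \<Longrightarrow> f v = (\<Sum>b\<in>Basis. (v \<bullet> b) *\<^sub>R f b)"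
  by (subst euclidean_representation[symmetric, of v]) (simp only: linear_sum linear_cmul)

text \<open>In finite dimension, smoothness for every fixed argument suffices: the moving argument
  \<open>U x\<close> is expanded in the basis. Tensor fields are evaluated on smooth fields in this
  way.\<close>

lemma smooth_on_apply:
  assumes "open S" "\<And>v. smooth_on S (\<lambda>x. f x v)" "\<And>x. x \<in> S \<Longrightarrow> linear (f x)" "smooth_on S U"
  shows "smooth_on S (\<lambda>x. f x (U x))"
proof (rule smooth_on_cong[OF assms(1)])
  show "smooth_on S (\<lambda>x. \<Sum>b\<in>Basis. (U x \<bullet> b) *\<^sub>R f x b)"
    using assms smooth_on_bounded_linear[OF bounded_linear_inner_left assms(1,4)]
    by (intro smooth_on_sum smooth_on_bilinear[OF bounded_bilinear_scaleR]) auto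
qed (use assms(3) linear_basis_expansion in metis)

lemma smooth_on_vec:
  fixes f :: "'e::euclidean_space \<Rightarrow> real^'n"
  assumes "open S" "\<And>i. smooth_on S (\<lambda>x. f x $ i)"
  shows "smooth_on S f"
proof (rule smooth_on_cong[OF assms(1)])
  show "smooth_on S (\<lambda>x. \<Sum>i\<in>UNIV. f x $ i *\<^sub>R axis i 1)"
    using assms by (intro smooth_on_sum smooth_on_bilinear[OF bounded_bilinear_scaleR] smooth_on_const) auto
qed (simp add: basis_expansion flip: scalar_mult_eq_scaleR)

lemma smooth_on_det:
  fixes M :: "'e::euclidean_space \<Rightarrow> real^'n^'n"
  assumes "open S" "\<And>i j. smooth_on S (\<lambda>x. M x $ i $ j)"
  shows "smooth_on S (\<lambda>x. det (M x))"
  unfolding det_def using assms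
  by (intro smooth_on_sum smooth_on_prod smooth_on_bilinear[OF bounded_bilinear_mult] smooth_on_const)
    (auto simp: finite_permutations)

text \<open>Cramer's rule writes the components of the solution as quotients of determinants with
  smooth entries. The lemma serves the objects that are defined by duality with the metric, namely
  the Christoffel map and \<open>sharp\<close>.\<close>

lemma smooth_on_solve:
  fixes B :: "'e::euclidean_space \<Rightarrow> real^'n \<Rightarrow> real^'n \<Rightarrow> real"
  assumes S: "open S" and lin: "\<And>x w. x \<in> S \<Longrightarrow> linear (\<lambda>v. B x v w)"
    and inj: "\<And>x v. x \<in> S \<Longrightarrow> (\<And>i. B x v (axis i 1) = 0) \<Longrightarrow> v = 0"
    and B: "\<And>v w. smooth_on S (\<lambda>x. B x v w)" and f: "\<And>w. smooth_on S (\<lambda>x. f x w)"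
    and c: "\<And>x w. x \<in> S \<Longrightarrow> B x (c x) w = f x w"
  shows "smooth_on S c"
proof -
  define M where "M x = (\<chi> i j. B x (axis j 1) (axis i 1))" for x
  define b where "b x = (\<chi> i. f x (axis i 1))" for x
  have Mv: "(M x *v v) $ i = B x v (axis i 1)" if "x \<in> S" for x v i
  proof -
    have "B x v (axis i 1) = B x (\<Sum>j\<in>UNIV. v $ j *\<^sub>R axis j 1) (axis i 1)"
      by (simp add: basis_expansion flip: scalar_mult_eq_scaleR)
    also have "\<dots> = (\<Sum>j\<in>UNIV. v $ j * B x (axis j 1) (axis i 1))"
      by (simp add: linear_sum[OF lin[OF that]] linear_cmul[OF lin[OF that]])
    finally show ?thesis by (simp add: M_def matrix_vector_mult_def mult.commute)
  qed
  have det: "det (M x) \<noteq> 0" if "x \<in> S" for x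
  proof -
    have "\<forall>v. M x *v v = 0 \<longrightarrow> v = 0"
      using Mv[OF that] inj[OF that] by (metis zero_index)
    then show ?thesis
      by (metis invertible_det_nz matrix_left_invertible_ker invertible_left_inverse)
  qed
  have "c x = (\<chi> k. det (\<chi> i j. if j = k then b x $ i else M x $ i $ j) / det (M x))" if "x \<in> S" for x
    using cramer[OF det[OF that], of "c x" "b x"] Mv[OF that] c[OF that]
    by (simp add: vec_eq_iff b_def)
  then have ck: "c x $ k = det (\<chi> i j. if j = k then b x $ i else M x $ i $ j) * inverse (det (M x))"
    if "x \<in> S" for x k
    using that by (simp add: divide_inverse)
  have Ms: "smooth_on S (\<lambda>x. M x $ i $ j)" for i j by (simp add: M_def B)
  have bs: "smooth_on S (\<lambda>x. b x $ i)" for i by (simp add: b_def f)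
  show ?thesis
  proof (rule smooth_on_vec[OF S])
    fix k
    have "smooth_on S (\<lambda>x. det (\<chi> i j. if j = k then b x $ i else M x $ i $ j) * inverse (det (M x)))"
    proof (intro smooth_on_bilinear[OF bounded_bilinear_mult] smooth_on_inverse smooth_on_det S det Ms)
      show "smooth_on S (\<lambda>x. (\<chi> i j. if j = k then b x $ i else M x $ i $ j) $ i $ j)" for i j
        using bs Ms by (cases "j = k") auto
    qed
    then show "smooth_on S (\<lambda>x. c x $ k)"
      by (rule smooth_on_cong[OF S, rotated]) (simp add: ck)
  qed
qed

section \<open>Symmetry of second derivatives\<close>

lemma has_real_derivative_along_line:
  fixes f :: "'e::euclidean_space \<Rightarrow> real"
  assumes "smooth_on S f" "x + s *\<^sub>R a \<in> S"
  shows "((\<lambda>s. f (x + s *\<^sub>R a)) has_real_derivative FD f (x + s *\<^sub>R a) a) (at s)"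
proof -
  have "((\<lambda>s. x + s *\<^sub>R a) has_vector_derivative a) (at s)"
    by (auto intro!: derivative_eq_intros)
  then show ?thesis
    using vector_derivative_diff_chain_within[of "\<lambda>s. x + s *\<^sub>R a" a s UNIV f]
      smooth_on_has_derivative[OF assms] has_derivative_at_withinI
    by (fastforce simp: has_real_derivative_iff_has_vector_derivative o_def)
qed

text \<open>The mean value theorem is used twice: on the difference in direction \<open>b\<close> as
  a function of the step along \<open>a\<close>, and then on the derivative so obtained as a
  function of the step along \<open>b\<close>.\<close>

lemma second_difference_mvt:
  fixes f :: "'e::euclidean_space \<Rightarrow> real"
  assumes f: "smooth_on (ball x e) f" and h: "h > 0" "h * (norm a + norm b) < e"
  obtains p where "norm (p - x) \<le> h * (norm a + norm b)"
    "f (x + h *\<^sub>R a + h *\<^sub>R b) - f (x + h *\<^sub>R a) - f (x + h *\<^sub>R b) + f x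
       = h\<^sup>2 * FD (\<lambda>y. FD f y a) p b"
proof -
  let ?S = "ball x e"
  have bd: "norm (s *\<^sub>R a + t *\<^sub>R b) \<le> h * (norm a + norm b)" if "0 \<le> s" "s \<le> h" "0 \<le> t" "t \<le> h" for s t
  proof -
    have "norm (s *\<^sub>R a + t *\<^sub>R b) \<le> s * norm a + t * norm b"
      using that norm_triangle_ineq[of "s *\<^sub>R a" "t *\<^sub>R b"] by simp
    also have "\<dots> \<le> h * norm a + h * norm b"
      using that by (intro add_mono mult_right_mono) auto
    finally show ?thesis by (simp add: distrib_left)
  qed
  have inS: "x + s *\<^sub>R a + t *\<^sub>R b \<in> ?S" if "0 \<le> s" "s \<le> h" "0 \<le> t" "t \<le> h" for s t
  proof -
    have "dist x (x + s *\<^sub>R a + t *\<^sub>R b) = norm (s *\<^sub>R a + t *\<^sub>R b)"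
      unfolding dist_norm by (subst norm_minus_commute) (simp add: add.assoc)
    then show ?thesis using bd[OF that] h(2) by simp
  qed
  let ?\<phi> = "\<lambda>s. f ((x + h *\<^sub>R b) + s *\<^sub>R a) - f (x + s *\<^sub>R a)"
  have "(?\<phi> has_real_derivative
      (FD f ((x + h *\<^sub>R b) + s *\<^sub>R a) a - FD f (x + s *\<^sub>R a) a)) (at s)" if "0 \<le> s" "s \<le> h" for s
    using inS[OF that, of h] inS[OF that, of 0] h
    by (intro DERIV_diff has_real_derivative_along_line[OF f]) (auto simp: algebra_simps)
  then obtain s where s: "0 < s" "s < h"
    "?\<phi> h - ?\<phi> 0 = h * (FD f ((x + h *\<^sub>R b) + s *\<^sub>R a) a - FD f (x + s *\<^sub>R a) a)"
    using MVT2[of 0 h ?\<phi> "\<lambda>s. FD f ((x + h *\<^sub>R b) + s *\<^sub>R a) a - FD f (x + s *\<^sub>R a) a"] h by auto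
  let ?\<psi> = "\<lambda>t. FD f ((x + s *\<^sub>R a) + t *\<^sub>R b) a"
  have "(?\<psi> has_real_derivative FD (\<lambda>y. FD f y a) ((x + s *\<^sub>R a) + t *\<^sub>R b) b) (at t)"
    if "0 \<le> t" "t \<le> h" for t
    using inS[of s t] s that by (intro has_real_derivative_along_line[OF smooth_on_FD[OF f]]) auto
  then obtain t where t: "0 < t" "t < h"
    "?\<psi> h - ?\<psi> 0 = h * FD (\<lambda>y. FD f y a) ((x + s *\<^sub>R a) + t *\<^sub>R b) b"
    using MVT2[of 0 h ?\<psi> "\<lambda>t. FD (\<lambda>y. FD f y a) ((x + s *\<^sub>R a) + t *\<^sub>R b) b"] h by auto
  show thesis
  proof (rule that)
    show "norm ((x + s *\<^sub>R a) + t *\<^sub>R b - x) \<le> h * (norm a + norm b)"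
      using bd[of s t] s t by (simp add: add.assoc)
    show "f (x + h *\<^sub>R a + h *\<^sub>R b) - f (x + h *\<^sub>R a) - f (x + h *\<^sub>R b) + f x
       = h\<^sup>2 * FD (\<lambda>y. FD f y a) ((x + s *\<^sub>R a) + t *\<^sub>R b) b"
      using s(3) t(3) by (simp add: power2_eq_square algebra_simps)
  qed
qed

text \<open>The second difference is symmetric in \<open>a\<close> and \<open>b\<close>. So the two
  mixed derivatives take a common value at points \<open>p\<close> and \<open>q\<close> arbitrarily
  close to \<open>x\<close>, and by continuity they cannot differ at \<open>x\<close>.\<close>

lemma FD_FD_commute_real:
  fixes f :: "'e::euclidean_space \<Rightarrow> real"
  assumes "open S" "smooth_on S f" "x \<in> S"
  shows "FD (\<lambda>y. FD f y a) x b = FD (\<lambda>y. FD f y b) x a" (is "?F x = ?G x")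
proof (rule ccontr)
  assume ne: "?F x \<noteq> ?G x"
  obtain e where e: "e > 0" "ball x e \<subseteq> S" using assms(1,3) openE by blast
  have f: "smooth_on (ball x e) f" using smooth_on_subset assms(2) e(2) by blast
  have cont: "continuous_on (ball x e) (\<lambda>y. FD (\<lambda>y. FD f y c) y d)" for c d
    using f smooth_on_FD smooth_on_continuous by blast
  let ?\<epsilon> = "\<bar>?F x - ?G x\<bar> / 2"
  have "?\<epsilon> > 0" using ne by simp
  have "\<exists>d>0. \<forall>p. dist p x < d \<longrightarrow> dist (FD (\<lambda>y. FD f y c) p c') (FD (\<lambda>y. FD f y c) x c') < ?\<epsilon>" for c c'
  proof -
    have "continuous (at x) (\<lambda>y. FD (\<lambda>y. FD f y c) y c')"
      using cont continuous_on_eq_continuous_at[OF open_ball] e(1) centre_in_ball by blast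
    then show ?thesis using \<open>?\<epsilon> > 0\<close> unfolding continuous_at_eps_delta by blast
  qed
  from this[of a b] this[of b a] obtain d1 d2 where d: "d1 > 0" "d2 > 0"
    "\<And>p. dist p x < d1 \<Longrightarrow> dist (?F p) (?F x) < ?\<epsilon>"
    "\<And>p. dist p x < d2 \<Longrightarrow> dist (?G p) (?G x) < ?\<epsilon>"
    by blast
  \<comment> \<open>The summand 1 keeps \<open>K\<close> positive when both directions vanish, and
    it makes \<open>h * (norm a + norm b)\<close> strictly smaller than each of the radii
    \<open>e\<close>, \<open>d1\<close>, \<open>d2\<close>.\<close>
  define K where "K = norm a + norm b + 1"
  define h where "h = min e (min d1 d2) / K"
  have K: "K > 0" by (simp add: K_def add_nonneg_pos)
  have h: "h > 0" using K e d by (simp add: h_def)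
  have hK: "h * K = min e (min d1 d2)" using K by (simp add: h_def)
  have "h * (norm a + norm b) < h * K" using h by (simp add: K_def)
  then have hs: "h * (norm a + norm b) < e" "h * (norm a + norm b) < d1" "h * (norm a + norm b) < d2"
    using hK by auto
  obtain p where p: "norm (p - x) \<le> h * (norm a + norm b)"
    "f (x + h *\<^sub>R a + h *\<^sub>R b) - f (x + h *\<^sub>R a) - f (x + h *\<^sub>R b) + f x = h\<^sup>2 * ?F p"
    using second_difference_mvt[OF f h hs(1)] by blast
  obtain q where q: "norm (q - x) \<le> h * (norm b + norm a)"
    "f (x + h *\<^sub>R b + h *\<^sub>R a) - f (x + h *\<^sub>R b) - f (x + h *\<^sub>R a) + f x = h\<^sup>2 * ?G q"
    using second_difference_mvt[OF f h, of b a] hs(1) by (metis add.commute)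
  have "h\<^sup>2 * ?F p = h\<^sup>2 * ?G q" using p(2) q(2) by (simp add: algebra_simps)
  then have "?F p = ?G q" using h by simp
  moreover have "\<bar>?F p - ?F x\<bar> < ?\<epsilon>" "\<bar>?G q - ?G x\<bar> < ?\<epsilon>"
    using d(3)[of p] d(4)[of q] p(1) q(1) hs by (auto simp: dist_norm add.commute)
  ultimately show False by (simp add: abs_if field_simps split: if_splits)
qed

lemma FD_bounded_linear:
  assumes "bounded_linear h" "f differentiable (at x)"
  shows "FD (\<lambda>y. h (f y)) x v = h (FD f x v)"
proof -
  have "((\<lambda>y. h (f y)) has_derivative (\<lambda>v. h (FD f x v))) (at x)"
    using bounded_linear.has_derivative[OF assms(1)] assms(2) frechet_derivative_works by blast
  then show ?thesis using frechet_derivative_at by metis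
qed

lemma FD_FD_commute:
  assumes S: "open S" "smooth_on S f" "x \<in> S"
  shows "FD (\<lambda>y. FD f y a) x b = FD (\<lambda>y. FD f y b) x a"
proof (rule euclidean_eqI)
  fix c :: 'b
  let ?h = "\<lambda>v. v \<bullet> c"
  have h: "bounded_linear ?h" by (rule bounded_linear_inner_left)
  have *: "FD (\<lambda>y. FD f y a) x b \<bullet> c = FD (\<lambda>y. FD (\<lambda>y. f y \<bullet> c) y a) x b" for a b
  proof -
    have "FD (\<lambda>y. FD f y a) x b \<bullet> c = FD (\<lambda>y. FD f y a \<bullet> c) x b"
      using FD_bounded_linear[OF h smooth_on_differentiable[OF smooth_on_FD[OF S(2)] S(3)]] by simp
    also have "\<dots> = FD (\<lambda>y. FD (\<lambda>y. f y \<bullet> c) y a) x b"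
    proof (rule fun_cong[OF FD_cong(2)[OF S(1,3)]])
      show "FD (\<lambda>y. f y \<bullet> c) y a = FD f y a \<bullet> c" if "y \<in> S" for y
        using FD_bounded_linear[OF h smooth_on_differentiable[OF S(2) that]] .
      show "(\<lambda>y. FD (\<lambda>y. f y \<bullet> c) y a) differentiable at x"
        by (rule smooth_on_differentiable[OF smooth_on_FD[OF smooth_on_bounded_linear[OF h S(1,2)]] S(3)])
    qed
    finally show ?thesis .
  qed
  show "FD (\<lambda>y. FD f y a) x b \<bullet> c = FD (\<lambda>y. FD f y b) x a \<bullet> c"
    unfolding * by (rule FD_FD_commute_real[OF S(1) smooth_on_bounded_linear[OF h S(1,2)] S(3)])
qed


section \<open>Chain and Leibniz rules along curves\<close>

lemma has_vector_derivative_compose_FD: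
  assumes "f differentiable (at (x t))" "(x has_vector_derivative x') (at t)"
  shows "((\<lambda>s. f (x s)) has_vector_derivative FD f (x t) x') (at t)"
proof -
  have "(f has_derivative FD f (x t)) (at (x t) within range x)"
    using assms(1) frechet_derivative_works has_derivative_at_withinI by blast
  then show ?thesis
    using vector_derivative_diff_chain_within[OF assms(2)] by (simp add: o_def)
qed

lemma has_vector_derivative_apply:
  fixes f :: "real \<Rightarrow> 'e::euclidean_space \<Rightarrow> 'f::real_normed_vector"
  assumes f: "\<And>v. ((\<lambda>s. f s v) has_vector_derivative f' v) (at t)"
    and N: "open N" "t \<in> N" and lin: "\<And>s. s \<in> N \<Longrightarrow> linear (f s)"
    and U: "(U has_vector_derivative U') (at t)"
  shows "((\<lambda>s. f s (U s)) has_vector_derivative f' (U t) + f t U') (at t)"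
proof -
  have key: "((\<lambda>s. f s (U s)) has_vector_derivative (\<Sum>b\<in>Basis. (U t \<bullet> b) *\<^sub>R f' b + (U' \<bullet> b) *\<^sub>R f t b)) (at t)"
    if U: "(U has_vector_derivative U') (at t)" for U U'
  proof (rule has_vector_derivative_transform_within_open[OF _ N])
    have "((\<lambda>s. U s \<bullet> b) has_real_derivative U' \<bullet> b) (at t)" for b
      using bounded_linear.has_vector_derivative[OF bounded_linear_inner_left U]
      by (simp add: has_real_derivative_iff_has_vector_derivative)
    then show "((\<lambda>s. \<Sum>b\<in>Basis. (U s \<bullet> b) *\<^sub>R f s b) has_vector_derivative
        (\<Sum>b\<in>Basis. (U t \<bullet> b) *\<^sub>R f' b + (U' \<bullet> b) *\<^sub>R f t b)) (at t)"
      by (intro has_vector_derivative_sum has_vector_derivative_scaleR f)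
  qed (use lin linear_basis_expansion in metis)
  \<comment> \<open>Linearity of \<open>f'\<close> comes from uniqueness of derivatives: the
    expansion for the constant field with value \<open>U t\<close> and the hypothesis on
    \<open>f\<close> at \<open>U t\<close> differentiate the same function.\<close>
  have "(\<Sum>b\<in>Basis. (U t \<bullet> b) *\<^sub>R f' b) = f' (U t)"
    using vector_derivative_unique_at[OF key[OF has_vector_derivative_const[of "U t"]] f[of "U t"]]
    by simp
  moreover have "(\<Sum>b\<in>Basis. (U' \<bullet> b) *\<^sub>R f t b) = f t U'"
    using linear_basis_expansion[OF lin[OF N(2)]] by metis
  ultimately show ?thesis using key[OF U] by (simp add: sum.distrib)
qed

section \<open>Covariant calculus in a chart\<close>

text \<open>The endomorphism \<open>L\<close> that represents \<open>B\<close> in the Euclidean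
  inner product is injective, hence surjective in finite dimension. Existence and uniqueness
  together justify the definite descriptions in \<open>christoffel\<close> and
  \<open>sharp\<close>.\<close>

lemma ex1_representing_vector:
  fixes B :: "'e::euclidean_space \<Rightarrow> 'e \<Rightarrow> real"
  assumes B: "bilinear B" "\<And>u. u \<noteq> 0 \<Longrightarrow> B u u \<noteq> 0" and f: "linear f"
  shows "\<exists>!c. \<forall>w. B c w = f w"
proof -
  define L where "L c = (\<Sum>b\<in>Basis. B c b *\<^sub>R b)" for c
  have L: "L c \<bullet> w = B c w" for c w
  proof -
    have "linear (B c)" using B(1) by (simp add: bilinear_def)
    then show ?thesis
      using linear_basis_expansion[of "B c" w]
      by (simp add: L_def inner_commute[of _ w] inner_sum_right mult.commute)
  qed
  have "linear L"
  proof (rule linearI)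
    show "L (x + y) = L x + L y" for x y
      by (rule euclidean_eqI) (simp add: L inner_add_left bilinear_ladd[OF B(1)])
    show "L (r *\<^sub>R x) = r *\<^sub>R L x" for r x
      by (rule euclidean_eqI) (simp add: L bilinear_lmul[OF B(1)])
  qed
  moreover have inj: "inj L"
  proof (subst linear_injective_0[OF \<open>linear L\<close>], intro allI impI)
    fix c assume "L c = 0"
    then have "B c c = 0" using L[of c c] by simp
    then show "c = 0" using B(2) by blast
  qed
  ultimately have "surj L" using linear_injective_imp_surjective by blast
  then obtain c where c: "L c = (\<Sum>b\<in>Basis. f b *\<^sub>R b)" by (metis surjD)
  have fc: "B c w = f w" for w
    using linear_basis_expansion[OF f, of w] L[of c w]
    by (simp add: c inner_commute[of _ w] inner_sum_right mult.commute)
  show ?thesis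
  proof (rule ex1I)
    show "\<forall>w. B c w = f w" using fc by simp
    fix d assume "\<forall>w. B d w = f w"
    then have "L d = L c" using L fc by (metis vector_eq_ldot inner_commute)
    then show "d = c" using inj by (simp add: inj_def)
  qed
qed

lemma linear_FD_arg:
  assumes V: "open V" "y \<in> V" and lin: "\<And>z. z \<in> V \<Longrightarrow> linear (f z)"
    and diff: "\<And>v. (\<lambda>z. f z v) differentiable (at y)"
  shows "linear (\<lambda>v. FD (\<lambda>z. f z v) y a)"
proof (rule linearI)
  have D: "((\<lambda>z. f z v) has_derivative FD (\<lambda>z. f z v) y) (at y)" for v
    using diff frechet_derivative_works by blast
  fix u v :: 'b and r :: real
  have "((\<lambda>z. f z (u + v)) has_derivative (\<lambda>a. FD (\<lambda>z. f z u) y a + FD (\<lambda>z. f z v) y a)) (at y)"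
    by (rule has_derivative_transform_within_open[OF has_derivative_add[OF D[of u] D[of v]] V])
      (simp add: lin linear_add)
  from fun_cong[OF frechet_derivative_at[OF this], of a]
  show "FD (\<lambda>z. f z (u + v)) y a = FD (\<lambda>z. f z u) y a + FD (\<lambda>z. f z v) y a" by simp
  have "((\<lambda>z. f z (r *\<^sub>R u)) has_derivative (\<lambda>a. r *\<^sub>R FD (\<lambda>z. f z u) y a)) (at y)"
    by (rule has_derivative_transform_within_open[OF has_derivative_scaleR_right[OF D[of u]] V])
      (simp add: lin linear_cmul)
  from fun_cong[OF frechet_derivative_at[OF this], of a]
  show "FD (\<lambda>z. f z (r *\<^sub>R u)) y a = r *\<^sub>R FD (\<lambda>z. f z u) y a" by simp
qed

text \<open>The right-hand side is linear in \<open>w\<close>, so a unique vector represents half of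
  it. The generality in \<open>G\<close> is used twice: for the metric in a chart, and for the
  metric induced on the parameter domain of the unit cotangent bundle.\<close>

lemma christoffel_koszul:
  assumes V: "open V" "y \<in> V" and bil: "\<And>z. z \<in> V \<Longrightarrow> bilinear (G z)"
    and nondeg: "\<And>u. u \<noteq> 0 \<Longrightarrow> G y u u \<noteq> 0"
    and diff: "\<And>u v. (\<lambda>z. G z u v) differentiable (at y)"
  shows "2 * G y (christoffel G y u v) w =
    FD (\<lambda>z. G z v w) y u + FD (\<lambda>z. G z u w) y v - FD (\<lambda>z. G z u v) y w"
proof -
  let ?f = "\<lambda>w. (FD (\<lambda>z. G z v w) y u + FD (\<lambda>z. G z u w) y v - FD (\<lambda>z. G z u v) y w) / 2"
  have lin: "linear (\<lambda>w. FD (\<lambda>z. G z v w) y u)" for v u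
    by (rule linear_FD_arg[OF V]) (use bil diff in \<open>auto simp: bilinear_def\<close>)
  note lin' = linear_frechet_derivative[OF diff]
  have "linear ?f"
    by (rule linearI) (simp_all add: linear_add[OF lin] linear_cmul[OF lin] linear_add[OF lin']
        linear_cmul[OF lin'] field_simps)
  then have "\<exists>!c. \<forall>w. G y c w = ?f w"
    using ex1_representing_vector[OF bil[OF V(2)] nondeg] by blast
  then have "\<exists>!c. \<forall>w. 2 * G y c w = FD (\<lambda>z. G z v w) y u + FD (\<lambda>z. G z u w) y v - FD (\<lambda>z. G z u v) y w"
    by (simp add: eq_divide_eq mult.commute)
  from theI'[OF this] show ?thesis unfolding christoffel_def by blast
qed

section \<open>Leibniz rules for fields of multilinear maps along a curve\<close>

lemma has_vector_derivative_eventually_in: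
  assumes "(x has_vector_derivative x') (at t)" "open V" "x t \<in> V"
  obtains N where "open N" "t \<in> N" "\<And>s. s \<in> N \<Longrightarrow> x s \<in> V"
proof -
  have "continuous (at t) x"
    using assms(1) has_vector_derivative_continuous by blast
  then have "\<forall>\<^sub>F s in nhds t. x s \<in> V"
    using assms(2,3) by (simp add: continuous_at_open eventually_nhds)
  then show ?thesis using that by (auto simp: eventually_nhds)
qed

lemma has_vector_derivative_field:
  fixes K :: "'e::euclidean_space \<Rightarrow> 'v::euclidean_space \<Rightarrow> 'f::euclidean_space"
  assumes V: "open V" "x t \<in> V"
    and K: "\<And>v. smooth_on V (\<lambda>y. K y v)" "\<And>y. y \<in> V \<Longrightarrow> linear (K y)"
    and x: "(x has_vector_derivative x') (at t)" and A: "(A has_vector_derivative A') (at t)"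
  shows "((\<lambda>s. K (x s) (A s)) has_vector_derivative
    FD (\<lambda>y. K y (A t)) (x t) x' + K (x t) A') (at t)"
proof -
  obtain N where N: "open N" "t \<in> N" "\<And>s. s \<in> N \<Longrightarrow> x s \<in> V"
    using has_vector_derivative_eventually_in[OF x V] by blast
  show ?thesis
    by (rule has_vector_derivative_apply[OF has_vector_derivative_compose_FD[OF _ x] N(1,2) _ A])
      (use K V N smooth_on_differentiable in blast)+
qed

lemma has_vector_derivative_field2:
  fixes K :: "'e::euclidean_space \<Rightarrow> 'u::euclidean_space \<Rightarrow> 'v::euclidean_space \<Rightarrow> 'f::euclidean_space"
  assumes V: "open V" "x t \<in> V"
    and K: "\<And>u v. smooth_on V (\<lambda>y. K y u v)" "\<And>y u. y \<in> V \<Longrightarrow> linear (K y u)"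
      "\<And>y v. y \<in> V \<Longrightarrow> linear (\<lambda>u. K y u v)"
    and x: "(x has_vector_derivative x') (at t)"
    and A: "(A has_vector_derivative A') (at t)" and B: "(B has_vector_derivative B') (at t)"
  shows "((\<lambda>s. K (x s) (A s) (B s)) has_vector_derivative
    FD (\<lambda>y. K y (A t) (B t)) (x t) x' + K (x t) A' (B t) + K (x t) (A t) B') (at t)"
proof -
  obtain N where N: "open N" "t \<in> N" "\<And>s. s \<in> N \<Longrightarrow> x s \<in> V"
    using has_vector_derivative_eventually_in[OF x V] by blast
  show ?thesis
    by (rule has_vector_derivative_apply[where f = "\<lambda>s. K (x s) (A s)", OF
          has_vector_derivative_field[where K = "\<lambda>y u. K y u v" for v, OF V K(1,3) x A] N(1,2) K(2) B])
      (use N in auto)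
qed

lemma has_vector_derivative_field3:
  fixes K :: "'e::euclidean_space \<Rightarrow> 'u::euclidean_space \<Rightarrow> 'v::euclidean_space \<Rightarrow> 'w::euclidean_space
    \<Rightarrow> 'f::euclidean_space"
  assumes V: "open V" "x t \<in> V"
    and K: "\<And>u v w. smooth_on V (\<lambda>y. K y u v w)" "\<And>y u v. y \<in> V \<Longrightarrow> linear (K y u v)"
      "\<And>y u w. y \<in> V \<Longrightarrow> linear (\<lambda>v. K y u v w)" "\<And>y v w. y \<in> V \<Longrightarrow> linear (\<lambda>u. K y u v w)"
    and x: "(x has_vector_derivative x') (at t)"
    and A: "(A has_vector_derivative A') (at t)" and B: "(B has_vector_derivative B') (at t)"
    and C: "(C has_vector_derivative C') (at t)"
  shows "((\<lambda>s. K (x s) (A s) (B s) (C s)) has_vector_derivative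
    FD (\<lambda>y. K y (A t) (B t) (C t)) (x t) x' + K (x t) A' (B t) (C t) + K (x t) (A t) B' (C t)
      + K (x t) (A t) (B t) C') (at t)"
proof -
  obtain N where N: "open N" "t \<in> N" "\<And>s. s \<in> N \<Longrightarrow> x s \<in> V"
    using has_vector_derivative_eventually_in[OF x V] by blast
  show ?thesis
    by (rule has_vector_derivative_apply[where f = "\<lambda>s. K (x s) (A s) (B s)", OF
          has_vector_derivative_field2[where K = "\<lambda>y u v. K y u v w" for w, OF V K(1,3,4) x A B]
          N(1,2) K(2) C])
      (use N in auto)
qed

lemma has_vector_derivative_line: "((\<lambda>s. x + s *\<^sub>R b) has_vector_derivative b) (at s)"
  by (auto intro!: derivative_eq_intros)

text \<open>Reduces a directional derivative to a curve derivative along a straight line. This lets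
  the product rules for covariant derivatives compute second derivatives of the metric and of
  \<open>J\<close>.\<close>

lemma FD_eqI:
  fixes f :: "'e::euclidean_space \<Rightarrow> 'f::euclidean_space"
  assumes "f differentiable (at x)" "((\<lambda>s. f (x + s *\<^sub>R b)) has_vector_derivative d) (at 0)"
  shows "FD f x b = d"
proof -
  have "((\<lambda>s. f (x + s *\<^sub>R b)) has_vector_derivative FD f (x + 0 *\<^sub>R b) b) (at 0)"
    using assms(1) by (intro has_vector_derivative_compose_FD has_vector_derivative_line) simp
  then show ?thesis using assms(2) vector_derivative_unique_at by fastforce
qed

section \<open>The Levi-Civita connection of a metric in coordinates\<close>

locale metric_coords =
  fixes V :: "(real^'n) set" and G :: "(real^'n) metric"
  assumes open_V: "open V"
    and G_bilinear: "y \<in> V \<Longrightarrow> bilinear (G y)"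
    and G_sym: "y \<in> V \<Longrightarrow> G y u v = G y v u"
    and G_pos: "y \<in> V \<Longrightarrow> u \<noteq> 0 \<Longrightarrow> G y u u > 0"
    and G_smooth: "smooth_on V (\<lambda>y. G y u v)"
begin

abbreviation \<Gamma> where "\<Gamma> \<equiv> christoffel G"
abbreviation R where "R \<equiv> curvature G"

lemma G_linear: "y \<in> V \<Longrightarrow> linear (G y u)" "y \<in> V \<Longrightarrow> linear (\<lambda>u. G y u v)"
  using G_bilinear by (auto simp: bilinear_def)

lemmas G_simps = linear_add[OF G_linear(1)] linear_add[OF G_linear(2)]
  linear_diff[OF G_linear(1)] linear_diff[OF G_linear(2)]
  linear_cmul[OF G_linear(1)] linear_cmul[OF G_linear(2)]
  linear_neg[OF G_linear(1)] linear_neg[OF G_linear(2)]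
  linear_0[OF G_linear(1)] linear_0[OF G_linear(2)]

lemma G_eq_0D: "y \<in> V \<Longrightarrow> G y u u = 0 \<Longrightarrow> u = 0"
  using G_pos by force

lemma G_eqI:
  assumes "y \<in> V" "\<And>w. G y a w = G y b w"
  shows "a = b"
  using G_eq_0D[OF assms(1), of "a - b"] assms by (simp add: G_simps)

lemma G_axis_eq_0D:
  assumes y: "y \<in> V" and axis: "\<And>i. G y v (axis i 1) = 0"
  shows "v = 0"
proof -
  have "G y v v = 0"
    unfolding linear_basis_expansion[OF G_linear(1)[OF y], of v v]
    by (rule sum.neutral) (use axis in \<open>auto simp: Basis_vec_def\<close>)
  then show ?thesis using G_eq_0D y by blast
qed

lemma G_differentiable: "y \<in> V \<Longrightarrow> (\<lambda>y. G y u v) differentiable (at y)"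
  using G_smooth smooth_on_differentiable by blast

lemma \<Gamma>_koszul:
  assumes "y \<in> V"
  shows "2 * G y (\<Gamma> y u v) w = FD (\<lambda>z. G z v w) y u + FD (\<lambda>z. G z u w) y v - FD (\<lambda>z. G z u v) y w"
  by (rule christoffel_koszul[OF open_V assms])
    (use assms G_bilinear G_differentiable G_eq_0D in blast)+

lemma FD_G_sym: "y \<in> V \<Longrightarrow> FD (\<lambda>z. G z u v) y = FD (\<lambda>z. G z v u) y"
  by (rule FD_cong(2)[OF open_V]) (auto intro: G_sym G_differentiable)

lemma \<Gamma>_sym: "y \<in> V \<Longrightarrow> \<Gamma> y u v = \<Gamma> y v u"
proof (rule G_eqI)
  fix w assume y: "y \<in> V"
  show "G y (\<Gamma> y u v) w = G y (\<Gamma> y v u) w"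
    using \<Gamma>_koszul[OF y, of u v w] \<Gamma>_koszul[OF y, of v u w] FD_G_sym[OF y, of u v] by simp
qed

lemma linear_FD_G: "y \<in> V \<Longrightarrow> linear (\<lambda>v. FD (\<lambda>z. G z v w) y a)"
  by (rule linear_FD_arg[OF open_V]) (auto intro: G_linear G_differentiable)

lemma \<Gamma>_linear1: "y \<in> V \<Longrightarrow> linear (\<lambda>u. \<Gamma> y u v)"
proof (rule linearI)
  assume y: "y \<in> V"
  note lin = linear_frechet_derivative[OF G_differentiable[OF y]] linear_FD_G[OF y]
  fix a b r
  show "\<Gamma> y (a + b) v = \<Gamma> y a v + \<Gamma> y b v"
  proof (rule G_eqI[OF y])
    fix w show "G y (\<Gamma> y (a + b) v) w = G y (\<Gamma> y a v + \<Gamma> y b v) w"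
      using \<Gamma>_koszul[OF y, of a v w] \<Gamma>_koszul[OF y, of b v w] \<Gamma>_koszul[OF y, of "a + b" v w]
      by (simp add: G_simps[OF y] linear_add[OF lin(1)] linear_add[OF lin(2)])
  qed
  show "\<Gamma> y (r *\<^sub>R a) v = r *\<^sub>R \<Gamma> y a v"
  proof (rule G_eqI[OF y])
    fix w
    have "2 * G y (\<Gamma> y (r *\<^sub>R a) v) w = r * (2 * G y (\<Gamma> y a v) w)"
      unfolding \<Gamma>_koszul[OF y] by (simp add: linear_cmul[OF lin(1)] linear_cmul[OF lin(2)] algebra_simps)
    then show "G y (\<Gamma> y (r *\<^sub>R a) v) w = G y (r *\<^sub>R \<Gamma> y a v) w" by (simp add: G_simps[OF y])
  qed
qed

lemma \<Gamma>_linear2: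
  assumes "y \<in> V"
  shows "linear (\<Gamma> y u)"
proof -
  have "\<Gamma> y u = (\<lambda>v. \<Gamma> y v u)" by (intro ext \<Gamma>_sym assms)
  then show ?thesis using \<Gamma>_linear1[OF assms, of u] by simp
qed

lemmas \<Gamma>_simps = linear_add[OF \<Gamma>_linear1] linear_add[OF \<Gamma>_linear2]
  linear_diff[OF \<Gamma>_linear1] linear_diff[OF \<Gamma>_linear2]
  linear_cmul[OF \<Gamma>_linear1] linear_cmul[OF \<Gamma>_linear2]
  linear_neg[OF \<Gamma>_linear1] linear_neg[OF \<Gamma>_linear2]
  linear_0[OF \<Gamma>_linear1] linear_0[OF \<Gamma>_linear2]

lemma \<Gamma>_smooth: "smooth_on V (\<lambda>y. \<Gamma> y u v)"
proof (rule smooth_on_solve[OF open_V G_linear(2) G_axis_eq_0D G_smooth])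
  let ?f = "\<lambda>y w. (1/2) *\<^sub>R (FD (\<lambda>z. G z v w) y u + FD (\<lambda>z. G z u w) y v - FD (\<lambda>z. G z u v) y w)"
  show "smooth_on V (\<lambda>y. ?f y w)" for w
    by (intro smooth_on_bounded_linear[OF bounded_linear_scaleR_right] smooth_on_add smooth_on_diff
        smooth_on_FD open_V G_smooth)
  show "G y (\<Gamma> y u v) w = ?f y w" if "y \<in> V" for y w
    using \<Gamma>_koszul[OF that, of u v w] by simp
qed

lemma \<Gamma>_differentiable: "y \<in> V \<Longrightarrow> (\<lambda>y. \<Gamma> y u v) differentiable (at y)"
  using \<Gamma>_smooth smooth_on_differentiable by blast

text \<open>Compatibility of the connection with the metric. In the sum of the Koszul formulas for
  \<open>\<Gamma> y a v\<close> tested on \<open>w\<close> and for \<open>\<Gamma> y a w\<close>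
  tested on \<open>v\<close>, all derivatives but those in direction \<open>a\<close>
  cancel.\<close>

lemma FD_G: "y \<in> V \<Longrightarrow> FD (\<lambda>z. G z v w) y a = G y (\<Gamma> y a v) w + G y v (\<Gamma> y a w)"
  using \<Gamma>_koszul[of y a v w] \<Gamma>_koszul[of y a w v] FD_G_sym[of y v w] FD_G_sym[of y a v]
    G_sym[of y v "\<Gamma> y a w"]
  by simp

lemma sharp: "y \<in> V \<Longrightarrow> G y (sharp G y \<omega>) X = \<omega> \<bullet> X"
proof -
  assume y: "y \<in> V"
  have "\<exists>!c. \<forall>w. G y c w = \<omega> \<bullet> w"
    using ex1_representing_vector[OF G_bilinear[OF y] _ bounded_linear.linear[OF bounded_linear_inner_right]]
      G_eq_0D[OF y] by blast
  from theI'[OF this] show ?thesis by (simp add: sharp_def)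
qed

lemma sharp_eqI: "y \<in> V \<Longrightarrow> (\<And>X. G y v X = \<omega> \<bullet> X) \<Longrightarrow> sharp G y \<omega> = v"
  by (rule G_eqI) (auto simp: sharp)

lemma sharp_linear: "y \<in> V \<Longrightarrow> linear (sharp G y)"
  by (intro linearI sharp_eqI) (auto simp: G_simps sharp inner_add_left)

lemma sharp_smooth: "smooth_on V (\<lambda>y. sharp G y \<omega>)"
  by (rule smooth_on_solve[OF open_V G_linear(2) G_axis_eq_0D G_smooth smooth_on_const[OF open_V] sharp])

lemma linear_FD_\<Gamma>: 
  "y \<in> V \<Longrightarrow> linear (\<lambda>v. FD (\<lambda>z. \<Gamma> z v w) y a)" "y \<in> V \<Longrightarrow> linear (\<lambda>v. FD (\<lambda>z. \<Gamma> z w v) y a)"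
  "y \<in> V \<Longrightarrow> linear (\<lambda>a. FD (\<lambda>z. \<Gamma> z w v) y a)"
    apply (rule linear_FD_arg[OF open_V]; auto intro: \<Gamma>_linear1 \<Gamma>_differentiable)
   apply (rule linear_FD_arg[OF open_V]; auto intro: \<Gamma>_linear2 \<Gamma>_differentiable)
  by (rule linear_frechet_derivative[OF \<Gamma>_differentiable])

lemma R_linear:
  assumes "y \<in> V"
  shows "linear (R y u v)" "linear (\<lambda>v. R y u v w)" "linear (\<lambda>u. R y u v w)"
  unfolding curvature_def using assms
  by (auto intro!: linearI simp: linear_add[OF linear_FD_\<Gamma>(1)] linear_add[OF linear_FD_\<Gamma>(2)]
      linear_add[OF linear_FD_\<Gamma>(3)] linear_cmul[OF linear_FD_\<Gamma>(1)] linear_cmul[OF linear_FD_\<Gamma>(2)]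
      linear_cmul[OF linear_FD_\<Gamma>(3)] \<Gamma>_simps algebra_simps)

lemmas R_simps = linear_add[OF R_linear(1)] linear_add[OF R_linear(2)] linear_add[OF R_linear(3)]
  linear_diff[OF R_linear(1)] linear_diff[OF R_linear(2)] linear_diff[OF R_linear(3)]
  linear_cmul[OF R_linear(1)] linear_cmul[OF R_linear(2)] linear_cmul[OF R_linear(3)]
  linear_neg[OF R_linear(1)] linear_neg[OF R_linear(2)] linear_neg[OF R_linear(3)]

lemma R_smooth: "smooth_on V (\<lambda>y. R y u v w)"
  unfolding curvature_def
  by (intro smooth_on_add smooth_on_diff smooth_on_FD \<Gamma>_smooth open_V
      smooth_on_apply[OF open_V \<Gamma>_smooth \<Gamma>_linear2 \<Gamma>_smooth])

lemma R_antisym: "R y u v w = - R y v u w"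
  by (simp add: curvature_def)

lemma FD_\<Gamma>_sym: "y \<in> V \<Longrightarrow> FD (\<lambda>z. \<Gamma> z u v) y = FD (\<lambda>z. \<Gamma> z v u) y"
  by (rule FD_cong(2)[OF open_V]) (auto intro: \<Gamma>_sym \<Gamma>_differentiable)

text \<open>Once the symmetry of \<open>\<Gamma>\<close> has brought the arguments into a common
  order, the terms cancel in pairs.\<close>

lemma bianchi: "y \<in> V \<Longrightarrow> R y u v w + R y v w u + R y w u v = 0"
  unfolding curvature_def
  by (simp add: FD_\<Gamma>_sym[of y w u] FD_\<Gamma>_sym[of y w v] FD_\<Gamma>_sym[of y v u]
      \<Gamma>_sym[of y w u] \<Gamma>_sym[of y w v] \<Gamma>_sym[of y v u])

section \<open>Covariant derivatives along curves\<close>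

lemma has_cov_deriv_iff:
  assumes "(x has_vector_derivative x') (at t)"
  shows "has_cov_deriv G x A W t \<longleftrightarrow> (A has_vector_derivative W - \<Gamma> (x t) x' (A t)) (at t)"
  using vector_derivative_at[OF assms] by (simp add: has_cov_deriv_def)

lemma cov_deriv_unique:
  "has_cov_deriv G x A W t \<Longrightarrow> has_cov_deriv G x A W' t \<Longrightarrow> W = W'"
  unfolding has_cov_deriv_def by (drule (1) vector_derivative_unique_at) simp

lemma cov_deriv_cong:
  assumes "open N" "t \<in> N" "\<And>s. s \<in> N \<Longrightarrow> A s = B s" "has_cov_deriv G x A W t"
  shows "has_cov_deriv G x B W t"
  using has_vector_derivative_transform_within_open[OF assms(4)[unfolded has_cov_deriv_def] assms(1-3)]
  by (simp add: has_cov_deriv_def assms(3)[OF assms(2)])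

lemma cov_deriv_add:
  assumes "x t \<in> V" "has_cov_deriv G x A A' t" "has_cov_deriv G x B B' t"
  shows "has_cov_deriv G x (\<lambda>s. A s + B s) (A' + B') t"
  using has_vector_derivative_add[OF assms(2,3)[unfolded has_cov_deriv_def]] assms(1)
  by (simp add: has_cov_deriv_def \<Gamma>_simps algebra_simps)

lemma cov_deriv_scaleR:
  assumes "x t \<in> V" "has_cov_deriv G x A A' t" "(f has_real_derivative f') (at t)"
  shows "has_cov_deriv G x (\<lambda>s. f s *\<^sub>R A s) (f' *\<^sub>R A t + f t *\<^sub>R A') t"
  using has_vector_derivative_scaleR[OF assms(3) assms(2)[unfolded has_cov_deriv_def]] assms(1)
  by (simp add: has_cov_deriv_def \<Gamma>_simps algebra_simps)

lemma cov_deriv_G: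
  assumes xV: "x t \<in> V" and x: "(x has_vector_derivative x') (at t)"
    and A: "has_cov_deriv G x A A' t" and B: "has_cov_deriv G x B B' t"
  shows "((\<lambda>s. G (x s) (A s) (B s)) has_real_derivative
    G (x t) A' (B t) + G (x t) (A t) B') (at t)"
proof -
  have "((\<lambda>s. G (x s) (A s) (B s)) has_vector_derivative
      FD (\<lambda>y. G y (A t) (B t)) (x t) x' + G (x t) (A' - \<Gamma> (x t) x' (A t)) (B t)
      + G (x t) (A t) (B' - \<Gamma> (x t) x' (B t))) (at t)"
    by (rule has_vector_derivative_field2[OF open_V xV G_smooth G_linear x])
      (use A B x has_cov_deriv_iff in auto)
  then show ?thesis
    by (simp add: FD_G xV G_simps[OF xV] has_real_derivative_iff_has_vector_derivative)
qed

lemma has_vector_derivative_\<Gamma>: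
  assumes xV: "x t \<in> V" and x: "(x has_vector_derivative x') (at t)"
    and A: "(A has_vector_derivative A') (at t)" and B: "(B has_vector_derivative B') (at t)"
  shows "((\<lambda>s. \<Gamma> (x s) (A s) (B s)) has_vector_derivative
    FD (\<lambda>y. \<Gamma> y (A t) (B t)) (x t) x' + \<Gamma> (x t) A' (B t) + \<Gamma> (x t) (A t) B') (at t)"
  by (rule has_vector_derivative_field2[OF open_V xV \<Gamma>_smooth \<Gamma>_linear2 \<Gamma>_linear1 x A B])

text \<open>\<open>x\<close>, \<open>x'\<close> are the curves \<open>\<tau> \<mapsto> q(\<tau>,0)\<close>, \<open>s \<mapsto> q(t,s)\<close> of a two-parameter family \<open>q\<close>, and \<open>u\<close>,
  \<open>u'\<close> are the restrictions to them of a field along \<open>q\<close>. The vectors \<open>m\<close>, \<open>n\<close> are the mixed second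
  derivatives of \<open>q\<close> and of the field.\<close>

lemma cov_deriv_commutator:
  assumes y: "x t = y" "x' s = y" "y \<in> V" and v: "u t = v" "u' s = v"
    and x: "(x has_vector_derivative a) (at t)" "(x' has_vector_derivative b) (at s)"
    and u: "(u has_vector_derivative u1' s) (at t)" "(u' has_vector_derivative u1 t) (at s)"
    and x1: "x1 t = b" "x1' s = a"
      "(x1 has_vector_derivative m) (at t)" "(x1' has_vector_derivative m) (at s)"
    and u1: "(u1 has_vector_derivative n) (at t)" "(u1' has_vector_derivative n) (at s)"
  obtains P Q where
    "has_cov_deriv G x (\<lambda>\<tau>. u1 \<tau> + \<Gamma> (x \<tau>) (x1 \<tau>) (u \<tau>)) P t"
    "has_cov_deriv G x' (\<lambda>\<tau>. u1' \<tau> + \<Gamma> (x' \<tau>) (x1' \<tau>) (u' \<tau>)) Q s"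
    "P = Q + R y a b v"
proof -
  define P where "P = n + (FD (\<lambda>z. \<Gamma> z b v) y a + \<Gamma> y m v + \<Gamma> y b (u1' s)) + \<Gamma> y a (u1 t + \<Gamma> y b v)"
  define Q where "Q = n + (FD (\<lambda>z. \<Gamma> z a v) y b + \<Gamma> y m v + \<Gamma> y a (u1 t)) + \<Gamma> y b (u1' s + \<Gamma> y a v)"
  have "has_cov_deriv G x (\<lambda>\<tau>. u1 \<tau> + \<Gamma> (x \<tau>) (x1 \<tau>) (u \<tau>)) P t"
    using has_vector_derivative_add[OF u1(1) has_vector_derivative_\<Gamma>[OF _ x(1) x1(3) u(1)]]
    by (simp add: y v x1 has_cov_deriv_iff[OF x(1)] P_def)
  moreover have "has_cov_deriv G x' (\<lambda>\<tau>. u1' \<tau> + \<Gamma> (x' \<tau>) (x1' \<tau>) (u' \<tau>)) Q s"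
    using has_vector_derivative_add[OF u1(2) has_vector_derivative_\<Gamma>[OF _ x(2) x1(4) u(2)]]
    by (simp add: y v x1 has_cov_deriv_iff[OF x(2)] Q_def)
  \<comment> \<open>The mixed derivatives \<open>m\<close> and \<open>n\<close> and the terms with
    \<open>u1 t\<close> and \<open>u1' s\<close> occur on both sides and cancel; what remains is the
    coordinate formula for the curvature.\<close>
  moreover have "P = Q + R y a b v"
    unfolding P_def Q_def curvature_def by (simp add: \<Gamma>_simps[OF y(3)])
  ultimately show thesis by (rule that)
qed

section \<open>Symmetries of the curvature tensor\<close>

text \<open>The formula \<open>FD_G\<close> is differentiated by \<open>cov_deriv_G\<close> along
  the line through \<open>y\<close> in direction \<open>b\<close>, on which a constant field
  \<open>c\<close> has the covariant derivative \<open>\<Gamma> y b c\<close> at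
  \<open>y\<close>.\<close>

lemma FD_FD_G:
  assumes y: "y \<in> V"
  shows "FD (\<lambda>y. FD (\<lambda>z. G z v w) y a) y b =
    G y (FD (\<lambda>z. \<Gamma> z a v) y b + \<Gamma> y b (\<Gamma> y a v)) w + G y (\<Gamma> y a v) (\<Gamma> y b w)
    + G y (\<Gamma> y b v) (\<Gamma> y a w) + G y v (FD (\<lambda>z. \<Gamma> z a w) y b + \<Gamma> y b (\<Gamma> y a w))"
proof (rule FD_eqI)
  let ?x = "\<lambda>s. y + s *\<^sub>R b"
  have x: "(?x has_vector_derivative b) (at 0)" and xV: "?x 0 \<in> V"
    using has_vector_derivative_line y by auto
  obtain N where N: "open N" "0 \<in> N" "\<And>s. s \<in> N \<Longrightarrow> ?x s \<in> V"
    using has_vector_derivative_eventually_in[OF x open_V xV] by blast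
  have cc: "has_cov_deriv G ?x (\<lambda>s. c) (\<Gamma> y b c) 0" for c
    by (simp add: has_cov_deriv_iff[OF x])
  have c\<Gamma>: "has_cov_deriv G ?x (\<lambda>s. \<Gamma> (?x s) a c) (FD (\<lambda>z. \<Gamma> z a c) y b + \<Gamma> y b (\<Gamma> y a c)) 0" for c
    using has_vector_derivative_compose_FD[OF \<Gamma>_differentiable x] y
    by (simp add: has_cov_deriv_iff[OF x])
  show "(\<lambda>y. FD (\<lambda>z. G z v w) y a) differentiable (at y)"
    using smooth_on_differentiable[OF smooth_on_FD[OF G_smooth] y] .
  show "((\<lambda>s. FD (\<lambda>z. G z v w) (?x s) a) has_vector_derivative
     G y (FD (\<lambda>z. \<Gamma> z a v) y b + \<Gamma> y b (\<Gamma> y a v)) w + G y (\<Gamma> y a v) (\<Gamma> y b w)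
    + G y (\<Gamma> y b v) (\<Gamma> y a w) + G y v (FD (\<lambda>z. \<Gamma> z a w) y b + \<Gamma> y b (\<Gamma> y a w))) (at 0)"
    by (rule has_vector_derivative_transform_within_open[OF _ N(1,2)
          FD_G[symmetric, OF N(3)]])
      (use DERIV_add[OF cov_deriv_G[OF xV x c\<Gamma>[of v] cc[of w]] cov_deriv_G[OF xV x cc[of v] c\<Gamma>[of w]]]
        in \<open>simp_all add: has_real_derivative_iff_has_vector_derivative add.assoc\<close>)
qed

text \<open>Interchanging \<open>a\<close> and \<open>b\<close> in \<open>FD_FD_G\<close> leaves the
  left-hand side unchanged and permutes the two middle terms. The differences of the outer terms are
  the two curvature expressions, so their sum vanishes.\<close>

lemma R_skew: "y \<in> V \<Longrightarrow> G y (R y a b v) w = - G y v (R y a b w)"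
  using FD_FD_commute[OF open_V G_smooth, of y v w a b]
  by (simp add: FD_FD_G curvature_def G_simps)

text \<open>The classical octahedron argument: a linear combination of the four Bianchi identities
  with cyclically shifted arguments, simplified by antisymmetry in the first and in the last
  pair.\<close>

lemma R_pair_sym:
  assumes y: "y \<in> V"
  shows "G y (R y a b c) d = G y (R y c d a) b"
proof -
  have B: "G y (R y a b c) d + G y (R y b c a) d + G y (R y c a b) d = 0" for a b c d
    using bianchi[OF y, of a b c] G_simps[OF y] by metis
  have S: "G y (R y a b c) d = - G y (R y a b d) c" for a b c d
    using R_skew[OF y, of a b c d] G_sym[OF y] by simp
  have A: "G y (R y a b c) d = - G y (R y b a c) d" for a b c d
    using R_antisym[of y a b c] G_simps[OF y] by metis
  show ?thesis
    using B[of a b c d] B[of b c d a] B[of c d a b] B[of d a b c]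
      S[of a b c d] S[of b c a d] S[of c a b d] S[of b d c a] S[of c d b a] S[of d a c b]
      S[of a c d b] S[of a b d c] S[of d b a c] S[of c d a b]
      A[of a b c d] A[of b c a d] A[of c a b d] A[of b d c a] A[of c d b a] A[of d a c b]
      A[of a c d b] A[of a b d c] A[of d b a c] A[of c d a b]
    by linarith
qed

section \<open>Smooth fields along maps, and parallel curvature\<close>

lemma smooth_on_along:
  assumes W: "open W" and X: "smooth_on W X" "X ` W \<subseteq> V"
    and A: "smooth_on W A" and B: "smooth_on W B"
  shows "smooth_on W (\<lambda>w. G (X w) (A w) (B w))" "smooth_on W (\<lambda>w. \<Gamma> (X w) (A w) (B w))"
    "smooth_on W (\<lambda>w. sharp G (X w) (A w))"
proof -
  have XV: "X w \<in> V" if "w \<in> W" for w using X that by blast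
  have G: "smooth_on W (\<lambda>w. G (X w) a b)" for a b
    using smooth_on_compose[OF W open_V G_smooth X] .
  have \<Gamma>: "smooth_on W (\<lambda>w. \<Gamma> (X w) a b)" for a b
    using smooth_on_compose[OF W open_V \<Gamma>_smooth X] .
  show "smooth_on W (\<lambda>w. sharp G (X w) (A w))"
    by (rule smooth_on_apply[OF W smooth_on_compose[OF W open_V sharp_smooth X] _ A])
      (use sharp_linear XV in blast)
  show "smooth_on W (\<lambda>w. G (X w) (A w) (B w))"
    by (rule smooth_on_apply[where f = "\<lambda>w. G (X w) (A w)", OF W
          smooth_on_apply[where f = "\<lambda>w a. G (X w) a b" for b, OF W G _ A] _ B])
      (use G_linear XV in blast)+
  show "smooth_on W (\<lambda>w. \<Gamma> (X w) (A w) (B w))"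
    by (rule smooth_on_apply[where f = "\<lambda>w. \<Gamma> (X w) (A w)", OF W
          smooth_on_apply[where f = "\<lambda>w a. \<Gamma> (X w) a b" for b, OF W \<Gamma> _ A] _ B])
      (use \<Gamma>_linear1 \<Gamma>_linear2 XV in blast)+
qed

lemma smooth_field_along_curve:
  assumes S: "open S" "t \<in> S" and x: "smooth_on S x" and E: "smooth_on S E"
  shows "(x has_vector_derivative FD x t 1) (at t)"
    and "has_cov_deriv G x E (FD E t 1 + \<Gamma> (x t) (FD x t 1) (E t)) t"
proof -
  have D: "(f has_vector_derivative FD f t 1) (at t)" if "smooth_on S f" for f :: "real \<Rightarrow> real^'n"
    using has_vector_derivative_compose_FD[where f = f and x = "\<lambda>s. s" and t = t and x' = 1]
      smooth_on_differentiable[OF that S(2)] by simp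
  show "(x has_vector_derivative FD x t 1) (at t)" by (rule D[OF x])
  then show "has_cov_deriv G x E (FD E t 1 + \<Gamma> (x t) (FD x t 1) (E t)) t"
    using D[OF E] by (simp add: has_cov_deriv_iff)
qed

text \<open>Local symmetry expresses the derivative of the components of \<open>R\<close> through
  Christoffel terms, and these turn the ordinary Leibniz rule into the covariant one without a term
  differentiating \<open>R\<close>.\<close>

lemma cov_deriv_R:
  assumes sym: "\<And>a u v w. nabla_curvature G (x t) a u v w = 0"
    and xV: "x t \<in> V" and x: "(x has_vector_derivative x') (at t)"
    and A: "has_cov_deriv G x A A' t" and B: "has_cov_deriv G x B B' t" and C: "has_cov_deriv G x C C' t"
  shows "has_cov_deriv G x (\<lambda>s. R (x s) (A s) (B s) (C s))
    (R (x t) A' (B t) (C t) + R (x t) (A t) B' (C t) + R (x t) (A t) (B t) C') t"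
proof -
  have "FD (\<lambda>z. R z (A t) (B t) (C t)) (x t) x' = - \<Gamma> (x t) x' (R (x t) (A t) (B t) (C t))
      + R (x t) (\<Gamma> (x t) x' (A t)) (B t) (C t) + R (x t) (A t) (\<Gamma> (x t) x' (B t)) (C t)
      + R (x t) (A t) (B t) (\<Gamma> (x t) x' (C t))"
    using sym[of x' "A t" "B t" "C t"] by (simp add: nabla_curvature_def algebra_simps)
  then show ?thesis
    unfolding has_cov_deriv_iff[OF x]
    by (intro has_vector_derivative_eq_rhs[OF has_vector_derivative_field3[OF open_V xV R_smooth R_linear x
            A[unfolded has_cov_deriv_iff[OF x]] B[unfolded has_cov_deriv_iff[OF x]]
            C[unfolded has_cov_deriv_iff[OF x]]]])
      (simp_all add: R_simps[OF xV])
qed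

section \<open>Frenet curvatures of a curve driven by a parallel skew-adjoint operator\<close>

text \<open>Here \<open>F\<close> abstracts the force operator of the geodesic problem. The
  connected set \<open>S\<close> of times is covered by a single chart, so vanishing derivatives
  yield constants on all of \<open>S\<close>.\<close>

lemma frenet_curvatures_locally_constant:
  fixes e :: "nat \<Rightarrow> real \<Rightarrow> real^'n" and k :: "nat \<Rightarrow> real \<Rightarrow> real"
  assumes S: "open S" "connected S" and xV: "\<And>t. t \<in> S \<Longrightarrow> x t \<in> V"
    and x: "\<And>t. t \<in> S \<Longrightarrow> (x has_vector_derivative x' t) (at t)" "\<And>t. t \<in> S \<Longrightarrow> x' t \<noteq> 0"
    and F: "\<And>t. t \<in> S \<Longrightarrow> linear (F t)" "\<And>t v. t \<in> S \<Longrightarrow> G (x t) (F t v) v = 0"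
    and F_parallel: "\<And>t E E'. t \<in> S \<Longrightarrow> has_cov_deriv G x E E' t
      \<Longrightarrow> has_cov_deriv G x (\<lambda>s. F s (E s)) (F t E') t"
    and x'': "\<And>t. t \<in> S \<Longrightarrow> has_cov_deriv G x x' (F t (x' t)) t"
    and e1: "\<And>t. t \<in> S \<Longrightarrow> e 1 t = x' t /\<^sub>R sqrt (G (x t) (x' t) (x' t))"
    and unit: "\<And>t i. t \<in> S \<Longrightarrow> i \<in> {1..r} \<Longrightarrow> G (x t) (e i t) (e i t) = 1"
    and k: "\<And>t i. t \<in> S \<Longrightarrow> i \<in> {1..<r} \<Longrightarrow> k i t \<ge> 0" "\<And>t i. t \<in> S \<Longrightarrow> i \<in> {1..<r - 1} \<Longrightarrow> k i t > 0"
    and frenet: "\<And>t i. t \<in> S \<Longrightarrow> i \<in> {1..<r} \<Longrightarrow> has_cov_deriv G x (e i)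
      (sqrt (G (x t) (x' t) (x' t)) *\<^sub>R ((if i = 1 then 0 else - (k (i - 1) t *\<^sub>R e (i - 1) t))
        + k i t *\<^sub>R e (i + 1) t)) t"
    and i: "i \<in> {1..<r}"
  shows "k i constant_on S"
proof (cases "S = {}")
  case False
  then obtain t0 where t0: "t0 \<in> S" by blast
  define Sol where "Sol E \<longleftrightarrow> (\<forall>t\<in>S. has_cov_deriv G x E (F t (E t)) t)" for E
  have Sol_cong: "Sol E'" if "Sol E" "\<And>t. t \<in> S \<Longrightarrow> E t = E' t" for E E'
    unfolding Sol_def
  proof
    fix t assume t: "t \<in> S"
    show "has_cov_deriv G x E' (F t (E' t)) t"
      using cov_deriv_cong[OF S(1) t that(2)] that t by (simp add: Sol_def)
  qed
  have Sol_F: "Sol E \<Longrightarrow> Sol (\<lambda>t. F t (E t))" for E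
    unfolding Sol_def using F_parallel by blast
  have Sol_cmul: "Sol (\<lambda>t. c *\<^sub>R E t)" if "Sol E" for c E
    unfolding Sol_def
  proof
    fix t assume t: "t \<in> S"
    show "has_cov_deriv G x (\<lambda>t. c *\<^sub>R E t) (F t (c *\<^sub>R E t)) t"
      using cov_deriv_scaleR[where x = x and A = E and A' = "F t (E t)" and f = "\<lambda>_. c" and f' = 0
          and t = t] xV[OF t] that t
      by (simp add: Sol_def linear_cmul[OF F(1)[OF t]])
  qed
  have Sol_add: "Sol (\<lambda>t. E t + E' t)" if "Sol E" "Sol E'" for E E'
    unfolding Sol_def
  proof
    fix t assume t: "t \<in> S"
    show "has_cov_deriv G x (\<lambda>t. E t + E' t) (F t (E t + E' t)) t"
      using cov_deriv_add[where x = x and A = E and B = E' and A' = "F t (E t)" and B' = "F t (E' t)" and t = t]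
        xV[OF t] that t by (simp add: Sol_def linear_add[OF F(1)[OF t]])
  qed
  have const: "G (x t) (E t) (E t) = G (x t0) (E t0) (E t0)" if E: "Sol E" and t: "t \<in> S" for E t
  proof -
    have "((\<lambda>t. G (x t) (E t) (E t)) has_real_derivative 0) (at t)" if t: "t \<in> S" for t
      using cov_deriv_G[OF xV[OF t] x(1)[OF t], of E _ E] E t F(2)[OF t] G_sym[OF xV[OF t]]
      by (fastforce simp: Sol_def)
    then have "(\<lambda>t. G (x t) (E t) (E t)) constant_on S"
      by (intro DERIV_zero_connected_constant_on[OF S(2,1), of "{}"] DERIV_continuous_on[of S _ "\<lambda>_. 0"])
        (auto intro: has_field_derivative_at_within)
    then show ?thesis using t t0 by (auto simp: constant_on_def)
  qed
  have Sol_x': "Sol x'" using x'' by (simp add: Sol_def)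
  define \<sigma> where "\<sigma> = sqrt (G (x t0) (x' t0) (x' t0))"
  have \<sigma>: "sqrt (G (x t) (x' t) (x' t)) = \<sigma>" if "t \<in> S" for t
    using const[OF Sol_x' that] by (simp add: \<sigma>_def)
  have \<sigma>_pos: "\<sigma> > 0" using G_pos xV x(2) t0 by (simp add: \<sigma>_def)
  have "Sol (e i) \<and> (\<forall>t\<in>S. k i t = k i t0)" if "i \<in> {1..<r}" for i
    using that
  proof (induction i rule: less_induct)
    case (less i)
    \<comment> \<open>The term with the preceding frame vector, its curvature frozen at
      \<open>t0\<close>, so that it is a constant multiple of a solution. It is zero for
      \<open>j = 1\<close>, where no predecessor exists.\<close>
    define prev where "prev j t = (if j = 1 then 0 else (\<sigma> * k (j - 1) t0) *\<^sub>R e (j - 1) t)" for j t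
    have step: "Sol (\<lambda>t. (\<sigma> * k j t) *\<^sub>R e (j + 1) t)"
      if j: "j \<in> {1..<r}" and ej: "Sol (e j)"
        and IH: "j > 1 \<Longrightarrow> Sol (e (j - 1)) \<and> (\<forall>t\<in>S. k (j - 1) t = k (j - 1) t0)" for j
    proof -
      have "Sol (prev j)"
      proof (cases "j = 1")
        case True
        then have "prev j = (\<lambda>t. 0 *\<^sub>R e j t)" by (simp add: prev_def fun_eq_iff)
        then show ?thesis using Sol_cmul[OF ej, of 0] by simp
      next
        case False
        then have "1 < j" using j by simp
        moreover have "prev j = (\<lambda>t. (\<sigma> * k (j - 1) t0) *\<^sub>R e (j - 1) t)"
          using False by (simp add: prev_def fun_eq_iff)
        ultimately show ?thesis using Sol_cmul[OF conjunct1[OF IH], of "\<sigma> * k (j - 1) t0"] by simp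
      qed
      \<comment> \<open>Differentiability is established for this sum and then transported along the
        Frenet formula to the product of \<open>k j\<close> and \<open>e (j + 1)\<close>. Neither
        factor need be known to be differentiable, which matters for the last frame vector.\<close>
      have "Sol (\<lambda>t. F t (e j t) + prev j t)"
        by (rule Sol_add[OF Sol_F[OF ej] \<open>Sol (prev j)\<close>])
      then show ?thesis
      proof (rule Sol_cong)
        fix t assume t: "t \<in> S"
        have "F t (e j t) = \<sigma> *\<^sub>R ((if j = 1 then 0 else - (k (j - 1) t *\<^sub>R e (j - 1) t)) + k j t *\<^sub>R e (j + 1) t)"
          using cov_deriv_unique[OF _ frenet[OF t j]] ej t \<sigma>[OF t] by (simp add: Sol_def)
        then show "F t (e j t) + prev j t = (\<sigma> * k j t) *\<^sub>R e (j + 1) t"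
          using IH j t by (cases "j = 1") (auto simp: prev_def algebra_simps)
      qed
    qed
    have ei: "Sol (e i)"
    proof (cases "i = 1")
      case True
      have "Sol (\<lambda>t. (1 / \<sigma>) *\<^sub>R x' t)" by (rule Sol_cmul[OF Sol_x'])
      then show ?thesis
        by (rule Sol_cong) (use e1 \<sigma> True in \<open>simp add: divide_inverse\<close>)
    next
      case False
      then have i: "i - 1 \<in> {1..<r - 1}" "i - 1 \<in> {1..<r}" "i - 1 < i" using less.prems by auto
      have IH: "Sol (e (i - 1)) \<and> (\<forall>t\<in>S. k (i - 1) t = k (i - 1) t0)"
        by (rule less.IH[OF i(3,2)])
      have "Sol (\<lambda>t. (\<sigma> * k (i - 1) t) *\<^sub>R e (i - 1 + 1) t)"
        by (rule step[OF i(2)]) (use IH less.IH less.prems in auto)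
      \<comment> \<open>Division is possible because \<open>i - 1\<close> lies below
        \<open>r - 1\<close>, where the curvatures are positive. By the induction hypothesis the
        divisor is constant, so the quotient is again a solution.\<close>
      then have "Sol (\<lambda>t. (1 / (\<sigma> * k (i - 1) t0)) *\<^sub>R (\<sigma> * k (i - 1) t) *\<^sub>R e (i - 1 + 1) t)"
        by (rule Sol_cmul)
      then show ?thesis
        by (rule Sol_cong) (use IH k(2)[OF t0 i(1)] \<sigma>_pos False less.prems in auto)
    qed
    have "Sol (\<lambda>t. (\<sigma> * k i t) *\<^sub>R e (i + 1) t)"
      by (rule step[OF less.prems ei]) (use less.IH less.prems in auto)
    note c = const[OF this]
    have "k i t = k i t0" if t: "t \<in> S" for t
    proof -
      \<comment> \<open>Both sides are squared lengths of the solution \<open>c\<close> at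
        \<open>t\<close> and at \<open>t0\<close>, because \<open>e (i + 1)\<close> is a unit
        vector. Nonnegativity of \<open>k i\<close> then removes the squares.\<close>
      have "(\<sigma> * k i t)\<^sup>2 = (\<sigma> * k i t0)\<^sup>2"
        using c[OF t] unit[OF t, of "i + 1"] unit[OF t0, of "i + 1"] less.prems
        by (simp add: G_simps xV t t0 power2_eq_square)
      then show ?thesis using \<sigma>_pos k(1)[OF t less.prems] k(1)[OF t0 less.prems]
        by (simp add: power2_eq_iff_nonneg)
    qed
    then show ?case using ei by blast
  qed
  then show ?thesis using i by (auto simp: constant_on_def)
qed (simp add: constant_on_def)

end

section \<open>Curvature identities of a Kaehler metric in coordinates\<close>

locale kaehler_coords = metric_coords V G
  for V :: "(real^'n) set" and G +
  fixes J :: "real^'n \<Rightarrow> real^'n \<Rightarrow> real^'n"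
  assumes J_linear: "y \<in> V \<Longrightarrow> linear (J y)"
    and J_smooth: "smooth_on V (\<lambda>y. J y u)"
    and J_square: "y \<in> V \<Longrightarrow> J y (J y u) = - u"
    and J_isometry: "y \<in> V \<Longrightarrow> G y (J y u) (J y v) = G y u v"
    and J_parallel: "y \<in> V \<Longrightarrow> nabla_endo G J y a u = 0"
begin

lemmas J_simps = linear_add[OF J_linear] linear_diff[OF J_linear] linear_cmul[OF J_linear]
  linear_neg[OF J_linear]

lemma J_skew: "y \<in> V \<Longrightarrow> G y (J y u) v = - G y u (J y v)"
  using J_isometry[of y u "J y v"] by (simp add: J_square G_simps)

lemma FD_J: "y \<in> V \<Longrightarrow> FD (\<lambda>z. J z u) y a = J y (\<Gamma> y a u) - \<Gamma> y a (J y u)"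
  using J_parallel[of y a u] by (simp add: nabla_endo_def algebra_simps)

lemma cov_deriv_J:
  assumes xV: "x t \<in> V" and x: "(x has_vector_derivative x') (at t)" and A: "has_cov_deriv G x A A' t"
  shows "has_cov_deriv G x (\<lambda>s. J (x s) (A s)) (J (x t) A') t"
  using has_vector_derivative_field[OF open_V xV J_smooth J_linear x A[unfolded has_cov_deriv_iff[OF x]]]
  by (simp add: has_cov_deriv_iff[OF x] FD_J xV J_simps[OF xV])

text \<open>\<open>FD_J\<close> is differentiated along a line in direction \<open>b\<close>: the
  first summand by \<open>cov_deriv_J\<close>, the second by the Leibniz rule for
  \<open>\<Gamma>\<close>.\<close>

lemma FD_FD_J:
  assumes y: "y \<in> V"
  shows "FD (\<lambda>y. FD (\<lambda>z. J z u) y a) y b =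
    J y (FD (\<lambda>z. \<Gamma> z a u) y b + \<Gamma> y b (\<Gamma> y a u)) - \<Gamma> y b (J y (\<Gamma> y a u))
    - (FD (\<lambda>z. \<Gamma> z a (J y u)) y b + \<Gamma> y a (J y (\<Gamma> y b u) - \<Gamma> y b (J y u)))"
proof (rule FD_eqI)
  let ?x = "\<lambda>s. y + s *\<^sub>R b"
  have x: "(?x has_vector_derivative b) (at 0)" and xV: "?x 0 \<in> V"
    using has_vector_derivative_line y by auto
  obtain N where N: "open N" "0 \<in> N" "\<And>s. s \<in> N \<Longrightarrow> ?x s \<in> V"
    using has_vector_derivative_eventually_in[OF x open_V xV] by blast
  have c\<Gamma>: "has_cov_deriv G ?x (\<lambda>s. \<Gamma> (?x s) a u) (FD (\<lambda>z. \<Gamma> z a u) y b + \<Gamma> y b (\<Gamma> y a u)) 0"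
    using has_vector_derivative_compose_FD[OF \<Gamma>_differentiable x] y
    by (simp add: has_cov_deriv_iff[OF x])
  have dJ: "((\<lambda>s. J (?x s) u) has_vector_derivative J y (\<Gamma> y b u) - \<Gamma> y b (J y u)) (at 0)"
    using has_vector_derivative_compose_FD[OF smooth_on_differentiable[OF J_smooth] x] y
    by (simp add: FD_J)
  have d\<Gamma>J: "((\<lambda>s. \<Gamma> (?x s) a (J (?x s) u)) has_vector_derivative
      FD (\<lambda>z. \<Gamma> z a (J y u)) y b + \<Gamma> y a (J y (\<Gamma> y b u) - \<Gamma> y b (J y u))) (at 0)"
    using has_vector_derivative_\<Gamma>[OF xV x has_vector_derivative_const[of a] dJ] y
    by (simp add: \<Gamma>_simps)
  show "(\<lambda>y. FD (\<lambda>z. J z u) y a) differentiable (at y)"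
    using smooth_on_differentiable[OF smooth_on_FD[OF J_smooth] y] .
  show "((\<lambda>s. FD (\<lambda>z. J z u) (?x s) a) has_vector_derivative
     J y (FD (\<lambda>z. \<Gamma> z a u) y b + \<Gamma> y b (\<Gamma> y a u)) - \<Gamma> y b (J y (\<Gamma> y a u))
    - (FD (\<lambda>z. \<Gamma> z a (J y u)) y b + \<Gamma> y a (J y (\<Gamma> y b u) - \<Gamma> y b (J y u)))) (at 0)"
    by (rule has_vector_derivative_transform_within_open[OF _ N(1,2) FD_J[symmetric, OF N(3)]])
      (use has_vector_derivative_diff[OF cov_deriv_J[OF xV x c\<Gamma>, unfolded has_cov_deriv_iff[OF x]] d\<Gamma>J]
        in simp_all)
qed

text \<open>Second derivatives of the components of \<open>J\<close> commute; antisymmetrizing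
  \<open>FD_FD_J\<close> in \<open>a\<close> and \<open>b\<close> leaves the commutator of the
  curvature operator with \<open>J\<close>.\<close>

lemma R_J: "y \<in> V \<Longrightarrow> R y a b (J y u) = J y (R y a b u)"
  using FD_FD_commute[OF open_V J_smooth, of y u a b]
  by (simp add: FD_FD_J curvature_def \<Gamma>_simps J_simps algebra_simps)

text \<open>Pair symmetry moves both copies of \<open>J\<close> to the other pair of arguments,
  where \<open>J\<close> commutes with the curvature operator and disappears because it is an
  isometry.\<close>

lemma R_J_J:
  assumes y: "y \<in> V"
  shows "R y (J y a) (J y b) u = R y a b u"
proof (rule G_eqI[OF y])
  fix w
  show "G y (R y (J y a) (J y b) u) w = G y (R y a b u) w"
    using R_pair_sym[OF y] by (metis R_J[OF y] J_isometry[OF y])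
qed

lemma R_J_left: "y \<in> V \<Longrightarrow> R y (J y a) b u = - R y a (J y b) u"
  using R_J_J[of y "J y a" b u] by (simp add: J_square R_simps)

lemma smooth_on_J_along:
  assumes "open W" "smooth_on W X" "X ` W \<subseteq> V" "smooth_on W A"
  shows "smooth_on W (\<lambda>w. J (X w) (A w))"
  by (rule smooth_on_apply[OF assms(1) smooth_on_compose[OF assms(1) open_V J_smooth assms(2,3)] _ assms(4)])
    (use assms J_linear in blast)

section \<open>Pointwise geodesic equations and the parallel force operator\<close>

text \<open>At a fixed time \<open>v\<close>, \<open>D\<close>, \<open>B\<close> are the dual field
  and its first two covariant derivatives, and \<open>a\<close>, \<open>A\<close> are velocity and
  acceleration of the base curve. The variation moves the base point by \<open>b\<close> and the
  field by \<open>k\<close>, tangent to the unit sphere. The tests \<open>b = 0\<close> with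
  \<open>k = J y v\<close>, \<open>b = 0\<close> with general \<open>k\<close>, and
  \<open>k = 0\<close> give the three claims.\<close>

lemma geodesic_equations_algebra:
  assumes y: "y \<in> V" and unit: "G y v v = 1" and perp: "G y D v = 0"
    and el: "\<And>b k. G y k v = 0 \<Longrightarrow> G y A b
      + G y (R y a b v) (D + (\<delta>\<^sup>2 * G y D (J y v)) *\<^sub>R J y v)
      + G y (B + (\<delta>\<^sup>2 * G y B (J y v)) *\<^sub>R J y v + (2 * \<delta>\<^sup>2 * G y D (J y v)) *\<^sub>R J y D) k = 0"
  shows "G y B (J y v) = 0"
    and "\<exists>l. B = l *\<^sub>R v - (2 * \<delta>\<^sup>2 * G y D (J y v)) *\<^sub>R J y D"
      (is "\<exists>l. B = l *\<^sub>R v - ?m *\<^sub>R J y D")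
    and "A = R y (D + (\<delta>\<^sup>2 * G y D (J y v)) *\<^sub>R J y v) v a"
proof -
  note G_simps = G_simps[OF y]
  have Jv: "G y (J y v) v = 0" using J_skew[OF y, of v v] G_sym[OF y] by simp
  have JJ: "G y (J y v) (J y v) = 1" "G y (J y D) (J y v) = 0"
    using J_isometry[OF y] unit perp by simp_all
  have el0: "G y (B + (\<delta>\<^sup>2 * G y B (J y v)) *\<^sub>R J y v + ?m *\<^sub>R J y D) k = 0" if "G y k v = 0" for k
    using el[OF that, of 0] by (simp add: linear_0[OF R_linear(2)[OF y]] G_simps)
  have "(1 + \<delta>\<^sup>2) * G y B (J y v) = 0"
    using el0[OF Jv] by (simp add: G_simps JJ algebra_simps)
  moreover have "1 + \<delta>\<^sup>2 \<noteq> 0" by (metis add_pos_nonneg less_irrefl zero_le_power2 zero_less_one)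
  ultimately show B0: "G y B (J y v) = 0" by simp
  let ?\<alpha> = "G y D (J y v)"
  have JDv: "G y (J y D) v = - ?\<alpha>" using J_skew[OF y] by simp
  \<comment> \<open>Only variations orthogonal to \<open>v\<close> are available, so a multiple of
    \<open>v\<close> stays free: the coefficient is the component of
    \<open>B + ?m *\<^sub>R J y D\<close> along \<open>v\<close>. The test vector below is the
    projection of \<open>w\<close> to the orthogonal complement.\<close>
  have "B = (G y B v - ?m * ?\<alpha>) *\<^sub>R v - ?m *\<^sub>R J y D"
  proof (rule G_eqI[OF y])
    fix w
    have "G y (w - G y w v *\<^sub>R v) v = 0" by (simp add: G_simps unit)
    from el0[OF this] show "G y B w = G y ((G y B v - ?m * ?\<alpha>) *\<^sub>R v - ?m *\<^sub>R J y D) w"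
      using G_sym[OF y, of w v] by (simp add: B0 G_simps JDv algebra_simps)
  qed
  then show "\<exists>l. B = l *\<^sub>R v - ?m *\<^sub>R J y D" by blast
  show "A = R y (D + (\<delta>\<^sup>2 * ?\<alpha>) *\<^sub>R J y v) v a" (is "A = R y ?w v a")
  proof (rule G_eqI[OF y])
    fix b
    have "G y A b + G y (R y a b v) ?w = 0" using el[of 0 b] by (simp add: G_simps)
    moreover have "G y (R y a b v) ?w = - G y (R y ?w v a) b"
      using R_pair_sym[OF y, of a b v ?w] R_antisym[of y v ?w a] by (simp add: G_simps)
    ultimately show "G y A b = G y (R y ?w v a) b" by simp
  qed
qed

text \<open>Since the coefficient \<open>G (Du, J u)\<close> is constant to first order, the first
  argument of the curvature has derivative \<open>l u - \<delta>\<^sup>2 \<alpha> J Du\<close>. In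
  the Leibniz rule the terms with repeated arguments vanish, and the other two cancel because
  \<open>R(J Du, u) = R(J u, Du)\<close>.\<close>

lemma force_parallel:
  assumes sym: "\<And>a u v w. nabla_curvature G (x t) a u v w = 0"
    and xV: "x t \<in> V" and x: "(x has_vector_derivative x') (at t)"
    and u: "has_cov_deriv G x u (Du t) t" and Du: "has_cov_deriv G x Du B t"
    and BJ: "G (x t) B (J (x t) (u t)) = 0"
    and B: "B = l *\<^sub>R u t - (2 * \<delta>\<^sup>2 * G (x t) (Du t) (J (x t) (u t))) *\<^sub>R J (x t) (Du t)"
    and E: "has_cov_deriv G x E E' t"
  shows "has_cov_deriv G x
    (\<lambda>s. R (x s) (Du s + (\<delta>\<^sup>2 * G (x s) (Du s) (J (x s) (u s))) *\<^sub>R J (x s) (u s)) (u s) (E s))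
    (R (x t) (Du t + (\<delta>\<^sup>2 * G (x t) (Du t) (J (x t) (u t))) *\<^sub>R J (x t) (u t)) (u t) E') t"
proof -
  let ?y = "x t" and ?v = "u t" and ?D = "Du t"
  let ?Jv = "J ?y ?v" and ?JD = "J ?y ?D"
  let ?\<alpha> = "G ?y ?D ?Jv"
  have Ju: "has_cov_deriv G x (\<lambda>s. J (x s) (u s)) ?JD t" using cov_deriv_J[OF xV x u] .
  have "G ?y ?D ?JD = 0" using J_skew[OF xV, of ?D ?D] G_sym[OF xV] by simp
  then have "((\<lambda>s. G (x s) (Du s) (J (x s) (u s))) has_real_derivative 0) (at t)"
    using cov_deriv_G[OF xV x Du Ju] BJ by simp
  from DERIV_cmult[OF this, of "\<delta>\<^sup>2"]
  have "((\<lambda>s. \<delta>\<^sup>2 * G (x s) (Du s) (J (x s) (u s))) has_real_derivative 0) (at t)" by simp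
  from cov_deriv_add[OF xV Du cov_deriv_scaleR[OF xV Ju this]]
  have w: "has_cov_deriv G x (\<lambda>s. Du s + (\<delta>\<^sup>2 * G (x s) (Du s) (J (x s) (u s))) *\<^sub>R J (x s) (u s))
      (B + (\<delta>\<^sup>2 * ?\<alpha>) *\<^sub>R ?JD) t" by simp
  have RR: "R ?y a a c = 0" for a c
  proof -
    have "2 *\<^sub>R R ?y a a c = 0" using R_antisym[of ?y a a c] by (simp add: scaleR_2)
    then show ?thesis by simp
  qed
  have c1: "R ?y ?JD ?v c = R ?y ?Jv ?D c" for c
    using R_J_left[OF xV, of ?D ?v c] R_antisym[of ?y ?Jv ?D c] by simp
  have c2: "B + (\<delta>\<^sup>2 * ?\<alpha>) *\<^sub>R ?JD = l *\<^sub>R ?v - (\<delta>\<^sup>2 * ?\<alpha>) *\<^sub>R ?JD"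
    unfolding B by (simp add: vec_eq_iff)
  have "R ?y (B + (\<delta>\<^sup>2 * ?\<alpha>) *\<^sub>R ?JD) ?v c + R ?y (?D + (\<delta>\<^sup>2 * ?\<alpha>) *\<^sub>R ?Jv) ?D c = 0" for c
    unfolding c2 by (simp add: R_simps[OF xV] RR c1)
  then show ?thesis using cov_deriv_R[OF sym xV x w u E] by simp
qed

end

section \<open>The Euler-Lagrange equation\<close>

text \<open>Models a parametrization of a piece of the cotangent bundle after passing to dual
  vectors: \<open>X\<close> is the base point, \<open>Y\<close> the vector dual to the
  covector.\<close>

locale field_along_map = kaehler_coords V G J
  for V :: "(real^'n) set" and G J +
  fixes W :: "'e::euclidean_space set" and X Y :: "'e \<Rightarrow> real^'n" and \<delta> :: real
  assumes open_W: "open W"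
    and X_smooth: "smooth_on W X" and X_V: "X ` W \<subseteq> V" and Y_smooth: "smooth_on W Y"
begin

text \<open>Covariant derivative of \<open>Y\<close> with respect to the Levi-Civita connection
  pulled back by \<open>X\<close>.\<close>

definition DY :: "'e \<Rightarrow> 'e \<Rightarrow> real^'n" where
  "DY w a = FD Y w a + \<Gamma> (X w) (FD X w a) (Y w)"

text \<open>The deformed Sasaki metric in terms of dual vectors; \<open>induced_berger\<close> below
  identifies it with the metric induced by \<open>bs_metric\<close>.\<close>

definition berger :: "'e metric" where
  "berger w a b = G (X w) (FD X w a) (FD X w b) + G (X w) (DY w a) (DY w b)
     + \<delta>\<^sup>2 * G (X w) (DY w a) (J (X w) (Y w)) * G (X w) (DY w b) (J (X w) (Y w))"

lemma X_in_V: "w \<in> W \<Longrightarrow> X w \<in> V"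
  using X_V by blast

lemma FD_X_linear: "w \<in> W \<Longrightarrow> linear (FD X w)" and FD_Y_linear: "w \<in> W \<Longrightarrow> linear (FD Y w)"
  using smooth_on_linear_FD X_smooth Y_smooth by blast+

lemma DY_linear: "w \<in> W \<Longrightarrow> linear (DY w)"
  unfolding DY_def
  by (rule linearI)
    (simp_all add: X_in_V \<Gamma>_simps linear_add[OF FD_X_linear] linear_add[OF FD_Y_linear]
      linear_cmul[OF FD_X_linear] linear_cmul[OF FD_Y_linear] algebra_simps)

lemma DY_smooth: "smooth_on W (\<lambda>w. DY w a)"
  unfolding DY_def
  by (intro smooth_on_add open_W smooth_on_FD Y_smooth smooth_on_along X_smooth X_V)

lemma berger_bilinear: "w \<in> W \<Longrightarrow> bilinear (berger w)"
  unfolding bilinear_def berger_def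
  by (auto intro!: linearI simp: X_in_V G_simps linear_add[OF FD_X_linear] linear_add[OF DY_linear]
      linear_cmul[OF FD_X_linear] linear_cmul[OF DY_linear] algebra_simps)

lemma berger_smooth: "smooth_on W (\<lambda>w. berger w a b)"
  unfolding berger_def
  by (intro smooth_on_add smooth_on_bilinear[OF bounded_bilinear_mult] open_W smooth_on_along
      smooth_on_J_along smooth_on_const smooth_on_FD DY_smooth X_smooth Y_smooth X_V)

lemma DY_line:
  assumes w: "w \<in> W"
  shows "has_cov_deriv G (\<lambda>s. X (w + s *\<^sub>R a)) (\<lambda>s. Y (w + s *\<^sub>R a)) (DY w a) 0"
    and "((\<lambda>s. X (w + s *\<^sub>R a)) has_vector_derivative FD X w a) (at 0)"
proof -
  have "((\<lambda>s. f (w + s *\<^sub>R a)) has_vector_derivative FD f w a) (at 0)" if "smooth_on W f"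
    for f :: "'e \<Rightarrow> real^'n"
    using has_vector_derivative_compose_FD[OF _ has_vector_derivative_line[of w a 0]]
      smooth_on_differentiable[OF that w] by simp
  from this[OF X_smooth] this[OF Y_smooth]
  show "has_cov_deriv G (\<lambda>s. X (w + s *\<^sub>R a)) (\<lambda>s. Y (w + s *\<^sub>R a)) (DY w a) 0"
    "((\<lambda>s. X (w + s *\<^sub>R a)) has_vector_derivative FD X w a) (at 0)"
    by (auto simp: has_cov_deriv_iff DY_def)
qed

text \<open>The two sides of the Euler-Lagrange equation for the variation \<open>z(\<tau>) + s w\<close> of a geodesic \<open>z\<close>.\<close>

lemma geodesic_first_variation:
  assumes H: "\<And>p a b. p \<in> W \<Longrightarrow> H p a b = berger p a b"
    and nondeg: "\<And>a. a \<noteq> 0 \<Longrightarrow> berger (z t) a a \<noteq> 0"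
    and N: "open N" "t \<in> N" "\<And>s. s \<in> N \<Longrightarrow> z s \<in> W"
    and z: "\<And>s. s \<in> N \<Longrightarrow> (z has_vector_derivative z' s) (at s)"
    and geod: "(z' has_vector_derivative - christoffel H (z t) (z' t) (z' t)) (at t)"
  obtains d where "((\<lambda>\<tau>. berger (z \<tau>) (z' \<tau>) w) has_real_derivative d) (at t)"
    "((\<lambda>s. berger (z t + s *\<^sub>R w) (z' t) (z' t)) has_real_derivative 2 * d) (at 0)"
proof -
  let ?p = "z t" and ?c = "z' t"
  have p: "?p \<in> W" using N by blast
  \<comment> \<open>\<open>H\<close> and \<open>berger\<close> are known to agree only on
    \<open>W\<close>. As \<open>W\<close> is open, their derivatives at \<open>z t\<close> agree as
    well, and the Koszul formula for \<open>H\<close> becomes one for \<open>berger\<close>.\<close>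
  have Hdiff: "(\<lambda>q. H q a b) differentiable (at ?p) \<and> FD (\<lambda>q. H q a b) ?p = FD (\<lambda>q. berger q a b) ?p" for a b
    using FD_cong[OF open_W p, of "\<lambda>q. berger q a b" "\<lambda>q. H q a b"] H
      smooth_on_differentiable[OF berger_smooth p] by simp
  have "bilinear (H q)" if "q \<in> W" for q
  proof -
    have "H q = berger q" using H[OF that] by blast
    then show ?thesis using berger_bilinear[OF that] by simp
  qed
  then have "2 * H ?p (christoffel H ?p ?c ?c) w =
      FD (\<lambda>q. H q ?c w) ?p ?c + FD (\<lambda>q. H q ?c w) ?p ?c - FD (\<lambda>q. H q ?c ?c) ?p w"
    by (intro christoffel_koszul[OF open_W p]) (use nondeg H[OF p] Hdiff in auto)
  then have koszul: "2 * berger ?p (christoffel H ?p ?c ?c) w =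
      2 * FD (\<lambda>q. berger q ?c w) ?p ?c - FD (\<lambda>q. berger q ?c ?c) ?p w"
    using Hdiff H[OF p] by simp
  have lin: "linear (\<lambda>a. berger q a w)" if "q \<in> W" for q
    using berger_bilinear[OF that] by (simp add: bilinear_def)
  let ?d = "FD (\<lambda>q. berger q ?c w) ?p ?c + berger ?p (- christoffel H ?p ?c ?c) w"
  have "((\<lambda>\<tau>. berger (z \<tau>) (z' \<tau>) w) has_real_derivative ?d) (at t)"
    using has_vector_derivative_field[where K = "\<lambda>q a. berger q a w", OF open_W p berger_smooth lin
        z[OF N(2)] geod]
    by (simp add: has_real_derivative_iff_has_vector_derivative)
  moreover have "((\<lambda>s. berger (?p + s *\<^sub>R w) ?c ?c) has_real_derivative FD (\<lambda>q. berger q ?c ?c) ?p w) (at 0)"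
    using has_vector_derivative_compose_FD[OF _ has_vector_derivative_line[of ?p w 0], of "\<lambda>q. berger q ?c ?c"]
      smooth_on_differentiable[OF berger_smooth p]
    by (simp add: has_real_derivative_iff_has_vector_derivative)
  moreover have "FD (\<lambda>q. berger q ?c ?c) ?p w = 2 * ?d"
    using koszul by (simp add: linear_neg[OF lin[OF p]])
  ultimately show thesis using that by simp
qed

text \<open>The number \<open>d\<close> of \<open>geodesic_first_variation\<close> is computed twice
  by product rules, along the geodesic and along the line through \<open>z t\<close> in direction
  \<open>w\<close>. The mixed covariant derivatives of \<open>X\<close> agree, those of the field
  differ by \<open>R y a b v\<close>, and comparison eliminates the second derivatives of the
  variation.\<close>

lemma euler_lagrange:
  assumes H: "\<And>p a b. p \<in> W \<Longrightarrow> H p a b = berger p a b"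
    and nondeg: "\<And>a. a \<noteq> 0 \<Longrightarrow> berger (z t) a a \<noteq> 0"
    and N: "open N" "t \<in> N" "\<And>s. s \<in> N \<Longrightarrow> z s \<in> W"
    and z: "\<And>s. s \<in> N \<Longrightarrow> (z has_vector_derivative z' s) (at s)"
    and geod: "(z' has_vector_derivative - christoffel H (z t) (z' t) (z' t)) (at t)"
    and xz: "\<And>s. s \<in> N \<Longrightarrow> x s = X (z s)" and uz: "\<And>s. s \<in> N \<Longrightarrow> u s = Y (z s)"
    and x: "\<And>s. s \<in> N \<Longrightarrow> (x has_vector_derivative x' s) (at s)"
    and u: "\<And>s. s \<in> N \<Longrightarrow> has_cov_deriv G x u (Du s) s"
    and A: "has_cov_deriv G x x' A t" and B: "has_cov_deriv G x Du B t"
  shows "G (x t) A (FD X (z t) w)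
    + G (x t) (R (x t) (x' t) (FD X (z t) w) (u t))
        (Du t + (\<delta>\<^sup>2 * G (x t) (Du t) (J (x t) (u t))) *\<^sub>R J (x t) (u t))
    + G (x t) (B + (\<delta>\<^sup>2 * G (x t) B (J (x t) (u t))) *\<^sub>R J (x t) (u t)
        + (2 * \<delta>\<^sup>2 * G (x t) (Du t) (J (x t) (u t))) *\<^sub>R J (x t) (Du t)) (DY (z t) w) = 0"
proof -
  define p where "p = z t"
  define c where "c = z' t"
  define y where "y = X p"
  define v where "v = Y p"
  define a where "a = FD X p c"
  define b where "b = FD X p w"
  define D where "D = DY p c"
  define E where "E = DY p w"
  have p: "p \<in> W" and y: "y \<in> V" using N X_in_V by (auto simp: p_def y_def)
  have comp: "((\<lambda>s. f (z s)) has_vector_derivative FD f (z s) (z' s)) (at s)"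
    if "s \<in> N" "smooth_on W f" for s and f :: "'e \<Rightarrow> real^'n"
    using has_vector_derivative_compose_FD[OF smooth_on_differentiable[OF that(2)] z] N that by blast
  have x': "x' s = FD X (z s) (z' s)" if "s \<in> N" for s
    using vector_derivative_unique_at[OF x[OF that]
        has_vector_derivative_transform_within_open[OF comp[OF that X_smooth] N(1) that xz[symmetric]]] .
  have u': "(u has_vector_derivative FD Y (z s) (z' s)) (at s)" if "s \<in> N" for s
    using has_vector_derivative_transform_within_open[OF comp[OF that Y_smooth] N(1) that uz[symmetric]] .
  have Du: "Du s = DY (z s) (z' s)" if "s \<in> N" for s
  proof -
    have "has_cov_deriv G x u (DY (z s) (z' s)) s"
      using u'[OF that] by (simp add: has_cov_deriv_iff[OF x[OF that]] DY_def x'[OF that] xz[OF that] uz[OF that])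
    then show ?thesis using cov_deriv_unique u[OF that] by blast
  qed
  have at_t: "x t = y" "u t = v" "x' t = a" "Du t = D"
    using N xz uz x' Du by (auto simp: y_def v_def a_def D_def p_def c_def)
  have xt: "(x has_vector_derivative a) (at t)" using x[OF N(2)] at_t by simp
  let ?l = "\<lambda>s. p + s *\<^sub>R w"
  have line: "(?l has_vector_derivative w) (at 0)" by (rule has_vector_derivative_line)
  obtain N' where N': "open N'" "0 \<in> N'" "\<And>s. s \<in> N' \<Longrightarrow> ?l s \<in> W"
    using has_vector_derivative_eventually_in[OF line open_W] p by auto
  have comp': "((\<lambda>s. f (?l s)) has_vector_derivative FD f p w) (at 0)"
    if "smooth_on W f" for f :: "'e \<Rightarrow> real^'n"
    using has_vector_derivative_compose_FD[OF _ line] smooth_on_differentiable[OF that p] by simp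
  let ?x = "\<lambda>s. X (?l s)" and ?u = "\<lambda>s. Y (?l s)"
  have xs: "(?x has_vector_derivative b) (at 0)" using comp'[OF X_smooth] by (simp add: b_def)
  define m where "m = FD (\<lambda>q. FD X q w) p c"
  define n where "n = FD (\<lambda>q. FD Y q w) p c"
  have m: "((\<lambda>\<tau>. FD X (z \<tau>) w) has_vector_derivative m) (at t)"
    "((\<lambda>s. FD X (?l s) c) has_vector_derivative m) (at 0)"
    using comp[OF N(2) smooth_on_FD[OF X_smooth, of w]] comp'[OF smooth_on_FD[OF X_smooth, of c]]
      FD_FD_commute[OF open_W X_smooth p, of w c] by (simp_all add: m_def p_def c_def)
  have n: "((\<lambda>\<tau>. FD Y (z \<tau>) w) has_vector_derivative n) (at t)"
    "((\<lambda>s. FD Y (?l s) c) has_vector_derivative n) (at 0)"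
    using comp[OF N(2) smooth_on_FD[OF Y_smooth, of w]] comp'[OF smooth_on_FD[OF Y_smooth, of c]]
      FD_FD_commute[OF open_W Y_smooth p, of w c] by (simp_all add: n_def p_def c_def)
  obtain P Q where PQ':
    "has_cov_deriv G x (\<lambda>\<tau>. FD Y (z \<tau>) w + \<Gamma> (x \<tau>) (FD X (z \<tau>) w) (u \<tau>)) P t"
    "has_cov_deriv G ?x (\<lambda>s. FD Y (?l s) c + \<Gamma> (?x s) (FD X (?l s) c) (?u s)) Q 0"
    and PQ: "P = Q + R y a b v"
  proof (rule cov_deriv_commutator[of x t y ?x 0 u v ?u a b "\<lambda>s. FD Y (?l s) c"
        "\<lambda>\<tau>. FD Y (z \<tau>) w" "\<lambda>\<tau>. FD X (z \<tau>) w" "\<lambda>s. FD X (?l s) c" m n])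
    show "(u has_vector_derivative FD Y (?l 0) c) (at t)" using u'[OF N(2)] by (simp add: p_def c_def)
    show "(?u has_vector_derivative FD Y (z t) w) (at 0)" using comp'[OF Y_smooth] by (simp add: p_def)
  qed (use y at_t xt xs m n in \<open>simp_all add: y_def v_def a_def b_def p_def\<close>)
  have P: "has_cov_deriv G x (\<lambda>\<tau>. DY (z \<tau>) w) P t"
    by (rule cov_deriv_cong[OF N(1,2) _ PQ'(1)]) (simp add: DY_def xz uz)
  have Q: "has_cov_deriv G ?x (\<lambda>s. DY (?l s) c) Q 0"
    using PQ'(2) by (simp add: DY_def)
  \<comment> \<open>The mixed covariant derivative of \<open>X\<close>, which by the symmetry of
    \<open>\<Gamma>\<close> is the same in both orders.\<close>
  define M where "M = m + \<Gamma> y a b"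
  have M: "has_cov_deriv G x (\<lambda>\<tau>. FD X (z \<tau>) w) M t" "has_cov_deriv G ?x (\<lambda>s. FD X (?l s) c) M 0"
    using m \<Gamma>_sym[OF y, of a b]
    by (simp_all add: has_cov_deriv_iff[OF xt] has_cov_deriv_iff[OF xs] M_def at_t a_def b_def y_def
        flip: p_def)
  have Ju: "has_cov_deriv G x (\<lambda>\<tau>. J (x \<tau>) (u \<tau>)) (J y D) t"
    using cov_deriv_J[OF _ xt u[OF N(2)]] at_t y by simp
  have Js: "has_cov_deriv G ?x (\<lambda>s. J (?x s) (?u s)) (J y E) 0"
    using cov_deriv_J[OF _ xs DY_line(1)[OF p, of w]] y by (simp add: y_def E_def)
  have xV: "x t \<in> V" "?x 0 \<in> V" using at_t y by (simp_all add: y_def)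
  note GA = cov_deriv_G[OF xV(1) xt] and GS = cov_deriv_G[OF xV(2) xs]
  let ?\<alpha> = "G y D (J y v)"
  obtain d where d: "((\<lambda>\<tau>. berger (z \<tau>) (z' \<tau>) w) has_real_derivative d) (at t)"
    "((\<lambda>s. berger (z t + s *\<^sub>R w) (z' t) (z' t)) has_real_derivative 2 * d) (at 0)"
    using geodesic_first_variation[OF H nondeg N z geod] by blast
  have "((\<lambda>\<tau>. G (x \<tau>) (x' \<tau>) (FD X (z \<tau>) w) + G (x \<tau>) (Du \<tau>) (DY (z \<tau>) w)
      + \<delta>\<^sup>2 * G (x \<tau>) (Du \<tau>) (J (x \<tau>) (u \<tau>)) * G (x \<tau>) (DY (z \<tau>) w) (J (x \<tau>) (u \<tau>)))
      has_real_derivative d) (at t)"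
    by (rule has_field_derivative_transform_within_open[OF d(1) N(1,2)])
      (simp add: berger_def xz uz x' Du)
  moreover have "((\<lambda>\<tau>. G (x \<tau>) (x' \<tau>) (FD X (z \<tau>) w) + G (x \<tau>) (Du \<tau>) (DY (z \<tau>) w)
      + \<delta>\<^sup>2 * G (x \<tau>) (Du \<tau>) (J (x \<tau>) (u \<tau>)) * G (x \<tau>) (DY (z \<tau>) w) (J (x \<tau>) (u \<tau>)))
      has_real_derivative (G y A b + G y a M) + (G y B E + G y D P)
      + ((\<delta>\<^sup>2 * (G y B (J y v) + G y D (J y D))) * G y E (J y v)
        + (G y P (J y v) + G y E (J y D)) * (\<delta>\<^sup>2 * ?\<alpha>))) (at t)"
    using DERIV_add[OF DERIV_add[OF GA[OF A M(1)] GA[OF B P]] DERIV_mult[OF DERIV_cmult[OF GA[OF B Ju]] GA[OF P Ju]]]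
    by (simp add: at_t b_def E_def p_def)
  ultimately have d1: "d = (G y A b + G y a M) + (G y B E + G y D P)
      + ((\<delta>\<^sup>2 * (G y B (J y v) + G y D (J y D))) * G y E (J y v)
        + (G y P (J y v) + G y E (J y D)) * (\<delta>\<^sup>2 * ?\<alpha>))"
    using DERIV_unique by blast
  have "((\<lambda>s. berger (?l s) c c) has_real_derivative (G y M a + G y a M) + (G y Q D + G y D Q)
      + ((\<delta>\<^sup>2 * (G y Q (J y v) + G y D (J y E))) * ?\<alpha> + (G y Q (J y v) + G y D (J y E)) * (\<delta>\<^sup>2 * ?\<alpha>))) (at 0)"
    unfolding berger_def
    using DERIV_add[OF DERIV_add[OF GS[OF M(2) M(2)] GS[OF Q Q]] DERIV_mult[OF DERIV_cmult[OF GS[OF Q Js]] GS[OF Q Js]]]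
    by (simp add: a_def y_def v_def D_def)
  then have d2: "2 * d = (G y M a + G y a M) + (G y Q D + G y D Q)
      + ((\<delta>\<^sup>2 * (G y Q (J y v) + G y D (J y E))) * ?\<alpha> + (G y Q (J y v) + G y D (J y E)) * (\<delta>\<^sup>2 * ?\<alpha>))"
    using DERIV_unique d(2) by (fastforce simp: p_def c_def)
  have JD: "G y D (J y D) = 0" "G y (J y D) E = G y E (J y D)" "G y D (J y E) = - G y E (J y D)"
    "G y (J y v) E = G y E (J y v)" "G y D Q = G y Q D" "G y M a = G y a M" "G y (R y a b v) D = G y D (R y a b v)"
    using J_skew[OF y, of D D] J_skew[OF y, of D E] G_sym[OF y] by simp_all
  have P: "G y D P = G y Q D + G y D (R y a b v)" "G y P (J y v) = G y Q (J y v) + G y (R y a b v) (J y v)"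
    using JD by (simp_all add: PQ G_simps[OF y])
  \<comment> \<open>The terms with \<open>M\<close> and \<open>Q\<close> cancel. Skewness of
    \<open>J\<close> lets the two remaining terms of the form \<open>G y E (J y D)\<close> add up,
    whence the factor 2.\<close>
  have "G y A b + G y (R y a b v) (D + (\<delta>\<^sup>2 * ?\<alpha>) *\<^sub>R J y v)
      + G y (B + (\<delta>\<^sup>2 * G y B (J y v)) *\<^sub>R J y v + (2 * \<delta>\<^sup>2 * ?\<alpha>) *\<^sub>R J y D) E = 0"
    using d1 d2 unfolding P by (simp add: G_simps[OF y] JD algebra_simps)
  then show ?thesis unfolding at_t by (simp add: b_def E_def p_def)
qed

text \<open>A dimension count: the pair of \<open>FD X p\<close> and \<open>DY p\<close> is
  injective, and since \<open>Y\<close> has unit length its range lies in the hyperplane of pairs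
  whose second entry is orthogonal to \<open>Y p\<close>. The dimensions agree, so base point and
  field can be varied independently within that hyperplane.\<close>

lemma tangent_surjective:
  assumes dim: "DIM('e) + 1 = 2 * CARD('n)" and p: "p \<in> W"
    and unit: "\<And>w. w \<in> W \<Longrightarrow> G (X w) (Y w) (Y w) = 1"
    and inj: "\<And>a. FD X p a = 0 \<Longrightarrow> DY p a = 0 \<Longrightarrow> a = 0"
    and K: "G (X p) k (Y p) = 0"
  obtains w where "FD X p w = b" "DY p w = k"
proof -
  define L where "L w = (FD X p w, DY p w)" for w
  \<comment> \<open>The Euclidean representative of the pairing with \<open>Y p\<close>; thus
    \<open>(0, q)\<close> is a normal vector of the hyperplane \<open>?S\<close>.\<close>
  define q where "q = (\<Sum>i\<in>Basis. G (X p) i (Y p) *\<^sub>R i)"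
  let ?S = "{Z. (0 :: real^'n, q) \<bullet> Z = 0}"
  have q: "q \<bullet> v = G (X p) v (Y p)" for v
    using linear_basis_expansion[OF G_linear(2)[OF X_in_V[OF p]], of v]
    by (simp add: q_def inner_commute[of _ v] inner_sum_right mult.commute)
  have L: "linear L"
    unfolding L_def by (intro linearI)
      (simp_all add: linear_add[OF FD_X_linear[OF p]] linear_add[OF DY_linear[OF p]]
        linear_cmul[OF FD_X_linear[OF p]] linear_cmul[OF DY_linear[OF p]])
  have "inj L" using inj linear_injective_0[OF L] by (auto simp: L_def zero_prod_def)
  have perp: "G (X p) (DY p w) (Y p) = 0" for w
  proof -
    have XV: "X (p + 0 *\<^sub>R w) \<in> V" using X_in_V[OF p] by simp
    obtain N where N: "open N" "0 \<in> N" "\<And>s. s \<in> N \<Longrightarrow> p + s *\<^sub>R w \<in> W"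
      using has_vector_derivative_eventually_in[OF has_vector_derivative_line open_W, of p 0 w] p by auto
    have D: "((\<lambda>s. G (X (p + s *\<^sub>R w)) (Y (p + s *\<^sub>R w)) (Y (p + s *\<^sub>R w))) has_real_derivative
        G (X p) (DY p w) (Y p) + G (X p) (Y p) (DY p w)) (at 0)"
      using cov_deriv_G[OF XV DY_line(2)[OF p, of w] DY_line(1)[OF p, of w] DY_line(1)[OF p, of w]]
      by simp
    have "((\<lambda>s. 1) has_real_derivative G (X p) (DY p w) (Y p) + G (X p) (Y p) (DY p w)) (at 0)"
      by (rule has_field_derivative_transform_within_open[OF D N(1,2)]) (simp add: unit N)
    then have "G (X p) (DY p w) (Y p) + G (X p) (Y p) (DY p w) = 0"
      using DERIV_const DERIV_unique by blast
    then show ?thesis using G_sym[OF X_in_V[OF p]] by simp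
  qed
  have "(0 :: real^'n, q) \<noteq> 0" using q[of "Y p"] unit[OF p] by (auto simp: zero_prod_def)
  then have "dim ?S = DIM((real^'n) \<times> (real^'n)) - 1" by (rule dim_hyperplane)
  also have "\<dots> = DIM('e)" using dim by simp
  also have "\<dots> = dim (range L)" using dim_image_eq[OF L, of UNIV] \<open>inj L\<close> by simp
  finally have "range L = ?S"
    by (intro subspace_dim_equal subspace_hyperplane linear_subspace_image[OF L] subspace_UNIV)
      (auto simp: L_def q perp)
  moreover have "(b, k) \<in> ?S" using K by (simp add: q)
  ultimately obtain w where "L w = (b, k)" by (metis imageE)
  then show thesis using that[of w] by (simp add: L_def)
qed

end

section \<open>Parametrizations of the unit cotangent bundle\<close>

locale cotangent_map = kaehler_coords V G J
  for V :: "(real^'n) set" and G J +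
  fixes W :: "'e::euclidean_space set" and \<psi> :: "'e \<Rightarrow> (real^'n) \<times> (real^'n)" and \<delta> :: real
  assumes open_W: "open W" and \<psi>_smooth: "smooth_on W \<psi>" and \<psi>_V: "fst ` \<psi> ` W \<subseteq> V"
begin

abbreviation "X \<equiv> \<lambda>w. fst (\<psi> w)"
abbreviation "Y \<equiv> \<lambda>w. sharp G (fst (\<psi> w)) (snd (\<psi> w))"

sublocale field_along_map V G J W X Y \<delta>
proof
  show "smooth_on W X" by (rule smooth_on_bounded_linear[OF bounded_linear_fst open_W \<psi>_smooth])
  moreover have "smooth_on W (\<lambda>w. snd (\<psi> w))"
    by (rule smooth_on_bounded_linear[OF bounded_linear_snd open_W \<psi>_smooth])
  moreover show "X ` W \<subseteq> V" using \<psi>_V by auto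
  ultimately show "smooth_on W Y" by (intro smooth_on_along open_W)
qed (rule open_W)

text \<open>The fibre component satisfies
  \<open>snd (\<psi> w) \<bullet> v = G (X w) (Y w) v\<close>. This is differentiated by
  \<open>cov_deriv_G\<close>, where the constant vector \<open>v\<close> contributes the Christoffel
  term.\<close>

lemma FD_\<psi>:
  assumes w: "w \<in> W"
  shows "fst (FD \<psi> w a) = FD X w a"
    and "snd (FD \<psi> w a) \<bullet> v = G (X w) (DY w a) v + snd (\<psi> w) \<bullet> \<Gamma> (X w) (FD X w a) v"
proof -
  note d = smooth_on_differentiable[OF \<psi>_smooth w]
  show "fst (FD \<psi> w a) = FD X w a"
    using FD_bounded_linear[OF bounded_linear_fst d] by simp
  have *: "bounded_linear (\<lambda>P. snd P \<bullet> v)" for v :: "real^'n"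
    by (rule bounded_linear_compose[OF bounded_linear_inner_left bounded_linear_snd])
  have "snd (FD \<psi> w a) \<bullet> v = FD (\<lambda>w. snd (\<psi> w) \<bullet> v) w a"
    using FD_bounded_linear[OF * d] by simp
  also have "\<dots> = G (X w) (DY w a) v + snd (\<psi> w) \<bullet> \<Gamma> (X w) (FD X w a) v"
  proof (rule FD_eqI)
    show "(\<lambda>w. snd (\<psi> w) \<bullet> v) differentiable at w"
      using smooth_on_differentiable[OF smooth_on_bounded_linear[OF * open_W \<psi>_smooth] w] .
    let ?l = "\<lambda>s. w + s *\<^sub>R a"
    obtain N where N: "open N" "0 \<in> N" "\<And>s. s \<in> N \<Longrightarrow> ?l s \<in> W"
      using has_vector_derivative_eventually_in[OF has_vector_derivative_line open_W, of w 0 a] w by auto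
    have xV: "X (?l 0) \<in> V" using X_in_V[OF w] by simp
    have c: "has_cov_deriv G (\<lambda>s. X (?l s)) (\<lambda>s. v) (\<Gamma> (X w) (FD X w a) v) 0"
      by (simp add: has_cov_deriv_iff[OF DY_line(2)[OF w]])
    have "((\<lambda>s. G (X (?l s)) (Y (?l s)) v) has_real_derivative
        G (X w) (DY w a) v + G (X w) (Y w) (\<Gamma> (X w) (FD X w a) v)) (at 0)"
      using cov_deriv_G[OF xV DY_line(2,1)[OF w] c] by simp
    then have "((\<lambda>s. G (X (?l s)) (Y (?l s)) v) has_vector_derivative
        G (X w) (DY w a) v + snd (\<psi> w) \<bullet> \<Gamma> (X w) (FD X w a) v) (at 0)"
      by (simp add: has_real_derivative_iff_has_vector_derivative sharp X_in_V[OF w])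
    then show "((\<lambda>s. snd (\<psi> (?l s)) \<bullet> v) has_vector_derivative
        G (X w) (DY w a) v + snd (\<psi> w) \<bullet> \<Gamma> (X w) (FD X w a) v) (at 0)"
      by (rule has_vector_derivative_transform_within_open[OF _ N(1,2)]) (simp add: sharp X_in_V N)
  qed
  finally show "snd (FD \<psi> w a) \<bullet> v = G (X w) (DY w a) v + snd (\<psi> w) \<bullet> \<Gamma> (X w) (FD X w a) v" .
qed

text \<open>The Christoffel term of \<open>FD_\<psi>\<close> is exactly the fibre component of the
  horizontal lift, so the vertical part is the covector dual to \<open>DY w a\<close>.\<close>

lemma vertical_part_\<psi>:
  assumes w: "w \<in> W"
  shows "vertical_part G (\<psi> w) (FD \<psi> w a) \<bullet> v = G (X w) (DY w a) v"
proof -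
  note X = X_in_V[OF w]
  let ?b = "FD X w a" and ?p = "snd (\<psi> w)"
  have "(\<chi> i. ?p \<bullet> \<Gamma> (X w) (axis i 1) ?b) \<bullet> v = ?p \<bullet> \<Gamma> (X w) ?b v"
  proof -
    have "(\<chi> i. ?p \<bullet> \<Gamma> (X w) (axis i 1) ?b) \<bullet> v = (\<Sum>i\<in>UNIV. ?p \<bullet> (v $ i *\<^sub>R \<Gamma> (X w) (axis i 1) ?b))"
      by (simp add: inner_vec_def sum_distrib_left mult_ac)
    also have "\<dots> = ?p \<bullet> \<Gamma> (X w) (\<Sum>i\<in>UNIV. v $ i *\<^sub>R axis i 1) ?b"
      by (simp add: inner_sum_right linear_sum[OF \<Gamma>_linear1[OF X]] linear_cmul[OF \<Gamma>_linear1[OF X]])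
    also have "\<dots> = ?p \<bullet> \<Gamma> (X w) ?b v"
      by (simp add: basis_expansion \<Gamma>_sym[OF X, of v] flip: scalar_mult_eq_scaleR)
    finally show ?thesis .
  qed
  moreover have "\<psi> w = (X w, ?p)" by simp
  ultimately show ?thesis
    unfolding vertical_part_def horizontal_lift_def
    by (simp add: case_prod_unfold FD_\<psi>[OF w] inner_diff_left)
qed

lemma sharp_vertical_part: "w \<in> W \<Longrightarrow> sharp G (X w) (vertical_part G (\<psi> w) (FD \<psi> w a)) = DY w a"
  by (rule sharp_eqI) (auto simp: vertical_part_\<psi> X_in_V)

lemma induced_berger:
  assumes w: "w \<in> W"
  shows "induced_metric \<psi> (bs_metric G J \<delta>) w a b = berger w a b"
proof -
  note X = X_in_V[OF w]
  \<comment> \<open>The minus sign is due to the skewness of \<open>J\<close>. It drops out of the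
    metric, in which this covector occurs once in each of two factors.\<close>
  have "sharp G (X w) (adjoint (J (X w)) (snd (\<psi> w))) = - J (X w) (Y w)"
  proof (rule sharp_eqI[OF X])
    fix v
    show "G (X w) (- J (X w) (Y w)) v = adjoint (J (X w)) (snd (\<psi> w)) \<bullet> v"
      using adjoint_works[OF J_linear[OF X], of v "snd (\<psi> w)"] J_skew[OF X, of "Y w" v]
      by (simp add: G_simps[OF X] sharp[OF X] inner_commute)
  qed
  then show ?thesis
    by (simp add: induced_metric_def bs_metric_def Let_def cometric_def sharp_vertical_part[OF w]
        FD_\<psi>[OF w] berger_def G_simps[OF X])
qed

text \<open>Turns injectivity of the derivative of a parametrization into the injectivity of the
  pair (\<open>FD X\<close>, \<open>DY\<close>) that \<open>tangent_surjective\<close>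
  needs.\<close>

lemma FD_\<psi>_eq_0:
  assumes w: "w \<in> W" and "FD X w a = 0" "DY w a = 0"
  shows "FD \<psi> w a = 0"
proof -
  have "snd (FD \<psi> w a) \<bullet> v = 0" for v
    using FD_\<psi>(2)[OF w, of a v] assms X_in_V[OF w] by (simp add: G_simps \<Gamma>_simps)
  then have "snd (FD \<psi> w a) = 0" by (metis inner_eq_zero_iff)
  moreover have "fst (FD \<psi> w a) = 0" using FD_\<psi>(1)[OF w] assms by simp
  ultimately show ?thesis by (simp add: prod_eq_iff)
qed

end

section \<open>Geodesic equations of the unit cotangent bundle in a chart\<close>

lemma (in kaehler_coords) geodesic_equations:
  fixes q :: "real \<Rightarrow> (real^'n) \<times> (real^'n)"
  assumes dim: "DIM('e::euclidean_space) + 1 = 2 * CARD('n)"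
    and geod: "geodesic_at TYPE('e) {(y, p). y \<in> V \<and> cometric G y p p = 1} (bs_metric G J \<delta>) q t"
    and I: "open I" "t \<in> I"
    and q: "\<And>s. s \<in> I \<Longrightarrow> fst (q s) = x s" "\<And>s. s \<in> I \<Longrightarrow> sharp G (x s) (snd (q s)) = u s"
    and x: "\<And>s. s \<in> I \<Longrightarrow> (x has_vector_derivative x' s) (at s)"
    and u: "\<And>s. s \<in> I \<Longrightarrow> has_cov_deriv G x u (Du s) s"
    and A: "has_cov_deriv G x x' A t" and B: "has_cov_deriv G x Du B t"
  shows "G (x t) B (J (x t) (u t)) = 0"
    and "\<exists>l. B = l *\<^sub>R u t - (2 * \<delta>\<^sup>2 * G (x t) (Du t) (J (x t) (u t))) *\<^sub>R J (x t) (Du t)"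
    and "A = R (x t) (Du t + (\<delta>\<^sup>2 * G (x t) (Du t) (J (x t) (u t))) *\<^sub>R J (x t) (u t)) (u t) (x' t)"
proof -
  let ?S = "{(y, p). y \<in> V \<and> cometric G y p p = 1}"
  let ?H = "\<lambda>\<psi> :: 'e \<Rightarrow> _. induced_metric \<psi> (bs_metric G J \<delta>)"
  obtain W and \<psi> :: "'e \<Rightarrow> (real^'n) \<times> (real^'n)" and N z where
    \<psi>: "local_parametrization ?S W \<psi>" and N: "open N" "t \<in> N" and z: "smooth_on N z"
    and zN: "\<And>s. s \<in> N \<Longrightarrow> z s \<in> W" "\<And>s. s \<in> N \<Longrightarrow> \<psi> (z s) = q s"
    and cov: "\<And>s. s \<in> N \<Longrightarrow> has_cov_deriv (?H \<psi>) z (\<lambda>r. vector_derivative z (at r)) 0 s"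
    using geod unfolding geodesic_at_def by blast
  have W: "open W" "smooth_on W \<psi>" "\<And>w. w \<in> W \<Longrightarrow> inj (FD \<psi> w)"
    using \<psi> unfolding local_parametrization_def by blast+
  have \<psi>S: "\<psi> ` W \<subseteq> ?S"
    using \<psi> openin_imp_subset[of _ ?S "\<psi> ` W"] unfolding local_parametrization_def by blast
  interpret C: cotangent_map V G J W \<psi> \<delta>
    by unfold_locales (use W \<psi>S in auto)
  have unit: "G (C.X w) (C.Y w) (C.Y w) = 1" if "w \<in> W" for w
    using \<psi>S that by (force simp: cometric_def)
  have inj: "a = 0" if "w \<in> W" "FD C.X w a = 0" "C.DY w a = 0" for w a
    using C.FD_\<psi>_eq_0[OF that] W(3)[OF that(1)]
      linear_injective_0[OF smooth_on_linear_FD[OF W(2) that(1)]] by blast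
  let ?N = "N \<inter> I"
  have N': "open ?N" "t \<in> ?N" using N I by auto
  define p where "p = z t"
  have p: "p \<in> W" and xV: "x t \<in> V" and xt: "x t = C.X p" and ut: "u t = C.Y p"
    using zN N C.X_in_V q I by (auto simp: p_def) (metis N(2))+
  \<comment> \<open>The metric is a sum of three nonnegative terms. The first two vanish together
    only if \<open>FD C.X p a\<close> and \<open>C.DY p a\<close> do, which forces
    \<open>a = 0\<close> because \<open>\<psi>\<close> is an immersion.\<close>
  have nondeg: "C.berger p a a \<noteq> 0" if "a \<noteq> 0" for a
  proof
    let ?G = "G (C.X p)"
    assume "C.berger p a a = 0"
    moreover have "?G k k \<ge> 0" for k
      using G_pos[OF C.X_in_V[OF p], of k] by (cases "k = 0") (auto simp: G_simps[OF C.X_in_V[OF p]])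
    moreover have "\<delta>\<^sup>2 * ?G (C.DY p a) (J (C.X p) (C.Y p)) * ?G (C.DY p a) (J (C.X p) (C.Y p)) \<ge> 0"
      by (simp add: mult.assoc)
    ultimately have "?G (FD C.X p a) (FD C.X p a) = 0" "?G (C.DY p a) (C.DY p a) = 0"
      unfolding C.berger_def by (smt (verit))+
    then show False using inj[OF p] G_eq_0D[OF C.X_in_V[OF p]] that by blast
  qed
  define z' where "z' s = vector_derivative z (at s)" for s
  have z': "(z has_vector_derivative z' s) (at s)" if "s \<in> N" for s
  proof -
    have "z differentiable (at s)" using smooth_on_differentiable[OF z that] .
    then show ?thesis unfolding z'_def using vector_derivative_works by blast
  qed
  have geod': "(z' has_vector_derivative - christoffel (?H \<psi>) (z t) (z' t) (z' t)) (at t)"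
    using cov[OF N(2)] by (simp add: has_cov_deriv_def z'_def[abs_def])
  have el: "G (x t) A (FD C.X p w)
    + G (x t) (R (x t) (x' t) (FD C.X p w) (u t))
        (Du t + (\<delta>\<^sup>2 * G (x t) (Du t) (J (x t) (u t))) *\<^sub>R J (x t) (u t))
    + G (x t) (B + (\<delta>\<^sup>2 * G (x t) B (J (x t) (u t))) *\<^sub>R J (x t) (u t)
        + (2 * \<delta>\<^sup>2 * G (x t) (Du t) (J (x t) (u t))) *\<^sub>R J (x t) (Du t)) (C.DY p w) = 0" for w
    unfolding p_def
  proof (rule C.euler_lagrange[where H = "?H \<psi>" and N = ?N and z = z and z' = z' and t = t and x = x
        and x' = x' and u = u and Du = Du and A = A and B = B])
    show "C.berger (z t) a a \<noteq> 0" if "a \<noteq> 0" for a using nondeg[OF that] by (simp add: p_def)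
  qed (use C.induced_berger N' zN z' geod' q x u A B in auto)
  have unit_t: "G (x t) (u t) (u t) = 1" using unit[OF p] by (simp add: xt ut)
  have "((\<lambda>s. G (x s) (u s) (u s)) has_real_derivative G (x t) (Du t) (u t) + G (x t) (u t) (Du t)) (at t)"
    using cov_deriv_G[OF xV x[OF I(2)] u[OF I(2)] u[OF I(2)]] .
  then have "((\<lambda>s. 1) has_real_derivative G (x t) (Du t) (u t) + G (x t) (u t) (Du t)) (at t)"
  proof (rule has_field_derivative_transform_within_open[OF _ N'])
    fix s assume "s \<in> ?N"
    then show "G (x s) (u s) (u s) = 1"
      using unit[of "z s"] zN[of s] q[of s] by auto
  qed
  then have "G (x t) (Du t) (u t) + G (x t) (u t) (Du t) = 0" using DERIV_const DERIV_unique by blast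
  then have perp: "G (x t) (Du t) (u t) = 0" using G_sym[OF xV, of "u t"] by simp
  have el': "G (x t) A b
    + G (x t) (R (x t) (x' t) b (u t)) (Du t + (\<delta>\<^sup>2 * G (x t) (Du t) (J (x t) (u t))) *\<^sub>R J (x t) (u t))
    + G (x t) (B + (\<delta>\<^sup>2 * G (x t) B (J (x t) (u t))) *\<^sub>R J (x t) (u t)
        + (2 * \<delta>\<^sup>2 * G (x t) (Du t) (J (x t) (u t))) *\<^sub>R J (x t) (Du t)) k = 0"
    if k: "G (x t) k (u t) = 0" for b k
  proof -
    obtain w where w: "FD C.X p w = b" "C.DY p w = k"
    proof (rule C.tangent_surjective[where p = p and k = k and b = b])
      show "G (C.X p) k (C.Y p) = 0" using k by (simp only: xt ut)
      show "G (C.X w) (C.Y w) (C.Y w) = 1" if "w \<in> W" for w by (rule unit[OF that])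
      show "a = 0" if "FD C.X p a = 0" "C.DY p a = 0" for a by (rule inj[OF p that])
    qed (use dim p in auto)
    then show ?thesis using el[of w] by (simp only: w)
  qed
  note eqs = geodesic_equations_algebra[OF xV unit_t perp el']
  show "G (x t) B (J (x t) (u t)) = 0" by (rule eqs(1))
  show "\<exists>l. B = l *\<^sub>R u t - (2 * \<delta>\<^sup>2 * G (x t) (Du t) (J (x t) (u t))) *\<^sub>R J (x t) (Du t)"
    by (rule eqs(2))
  show "A = R (x t) (Du t + (\<delta>\<^sup>2 * G (x t) (Du t) (J (x t) (u t))) *\<^sub>R J (x t) (u t)) (u t) (x' t)"
    by (rule eqs(3))
qed

section \<open>Passage from charts to the manifold\<close>

lemma (in kaehler_manifold) chart_kaehler_coords:
  assumes "c \<in> A"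
  shows "kaehler_coords (snd c ` fst c) (g c) (J c)"
  by unfold_locales
    (use assms in \<open>auto intro: chart_range g_bilinear g_sym g_pos g_smooth J_linear J_smooth J_square
      J_isometry J_parallel simp: linear_add[OF J_linear] linear_cmul[OF J_linear]\<close>)

theorem theorem5p14:
  fixes T :: "'a topology"
    and A :: "('a, 'n::finite) chart set"
    and g :: "('a, 'n) chart \<Rightarrow> real^'n \<Rightarrow> real^'n \<Rightarrow> real^'n \<Rightarrow> real"
    and J :: "('a, 'n) chart \<Rightarrow> real^'n \<Rightarrow> real^'n \<Rightarrow> real^'n"
    and \<delta> :: real
    and m r :: nat
    and I :: "real set"
    and \<gamma> :: "real \<Rightarrow> 'a"
    and \<theta> \<xi> :: "real \<Rightarrow> ('a, 'n) components"
    and C \<Gamma> :: "real \<Rightarrow> 'a \<times> ('a, 'n) components"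
    and \<nu> :: "nat \<Rightarrow> real \<Rightarrow> ('a, 'n) components"
    and k :: "nat \<Rightarrow> real \<Rightarrow> real"
  assumes "CARD('n) = 2 * m"
    and "DIM('e::euclidean_space) + 1 = 2 * CARD('n)"
    and "kaehler_manifold T A g J"
    and "locally_symmetric A g"
    and "open I" and "is_interval I"
    and "C = (\<lambda>t. (\<gamma> t, \<theta> t))"
    and "bs_geodesic TYPE('e) T A g J \<delta> I C"
    and "bs_arc_length_parametrized A g J \<delta> I C"
    and "\<xi> = (\<lambda>t. covector_J A J (\<gamma> t) (\<theta> t))"
    and "\<Gamma> = (\<lambda>t. (\<gamma> t, \<xi> t))"
    and "frenet_frame A g I (\<pi> \<circ> \<Gamma>) r \<nu> k"
  shows "\<forall>i\<in>{1..<r}. k i constant_on I"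
proof
  fix i assume i: "i \<in> {1..<r}"
  interpret M: kaehler_manifold T A g J by (rule assms(3))
  have \<pi>C: "\<pi> (C t) = \<gamma> t" "\<pi> \<circ> \<Gamma> = \<gamma>" for t
    using assms(7,11) by (auto simp: bundle_projection_def fun_eq_iff)
  note curve = assms(8)[unfolded bs_geodesic_def unit_cotangent_curve_def]
  note frenet = assms(12)[unfolded \<pi>C frenet_frame_def Let_def]
  have local_const: "\<exists>S. open S \<and> t0 \<in> S \<and> k i constant_on S" if t0: "t0 \<in> I" for t0
  proof -
    have "C t \<in> unit_cotangent_bundle T A g" if "t \<in> I" for t using curve that by blast
    then have "\<gamma> t0 \<in> topspace T"
      using t0 assms(7) by (auto simp: unit_cotangent_bundle_def cotangent_bundle_def)
    then obtain c where c: "c \<in> A" "\<gamma> t0 \<in> fst c" using M.cover by blast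
    let ?V = "snd c ` fst c"
    interpret K: kaehler_coords ?V "g c" "J c" by (rule M.chart_kaehler_coords[OF c(1)])
    have sym: "nabla_curvature (g c) y a u v w = 0" if "y \<in> ?V" for y a u v w
      using assms(4) c(1) that unfolding locally_symmetric_def by blast
    define I' where "I' = {t\<in>I. \<gamma> t \<in> fst c}"
    have "continuous_map (top_of_set I) T \<gamma>" using curve \<pi>C(1) by (simp add: o_def)
    from openin_continuous_map_preimage[OF this M.chart_domain[OF c(1)]]
    have I': "open I'" using assms(5) by (simp add: I'_def openin_open_eq)
    define q where "q = bundle_coords c \<circ> C"
    define x where "x = snd c \<circ> \<gamma>"
    define u where "u t = sharp (g c) (x t) (snd (q t))" for t
    have q_smooth: "smooth_on I' q" using curve c(1) \<pi>C(1) by (simp add: q_def I'_def)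
    have fst_q: "fst (q t) = x t" for t
      by (simp add: q_def x_def bundle_coords_def assms(7))
    have x_smooth: "smooth_on I' x"
      using smooth_on_bounded_linear[OF bounded_linear_fst I' q_smooth] by (simp add: fst_q)
    have xV: "x t \<in> ?V" if "t \<in> I'" for t using that by (auto simp: I'_def x_def)
    then have xV': "x ` I' \<subseteq> ?V" by blast
    have u_smooth: "smooth_on I' u"
      unfolding u_def using smooth_on_bounded_linear[OF bounded_linear_snd I' q_smooth]
      by (intro K.smooth_on_along(3)[OF I' x_smooth xV'])
    \<comment> \<open>For a curve, the Frechet derivative applied to \<open>1\<close> is the
      velocity. In this form \<open>smooth_on_FD\<close> applies, so \<open>x'\<close> and
      \<open>Du\<close> are smooth and can be differentiated again.\<close>
    define x' where "x' t = FD x t 1" for t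
    define Du where "Du t = FD u t 1 + christoffel (g c) (x t) (x' t) (u t)" for t
    define x'' where "x'' t = FD x' t 1 + christoffel (g c) (x t) (x' t) (x' t)" for t
    define DDu where "DDu t = FD Du t 1 + christoffel (g c) (x t) (x' t) (Du t)" for t
    have x'_smooth: "smooth_on I' x'" unfolding x'_def by (rule smooth_on_FD[OF x_smooth])
    have Du_smooth: "smooth_on I' Du"
      unfolding Du_def
      by (intro smooth_on_add I' smooth_on_FD u_smooth K.smooth_on_along(2) x_smooth xV' x'_smooth)
    note along = K.smooth_field_along_curve[OF I' _ x_smooth]
    have x: "(x has_vector_derivative x' t) (at t)" if "t \<in> I'" for t
      using along(1)[OF that x_smooth] by (simp add: x'_def)
    have cov: "has_cov_deriv (g c) x u (Du t) t" "has_cov_deriv (g c) x x' (x'' t) t"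
      "has_cov_deriv (g c) x Du (DDu t) t" if "t \<in> I'" for t
      using along(2)[OF that u_smooth] along(2)[OF that x'_smooth] along(2)[OF that Du_smooth]
      by (simp_all add: x'_def Du_def x''_def DDu_def)
    define F where "F t = curvature (g c) (x t)
      (Du t + (\<delta>\<^sup>2 * g c (x t) (Du t) (J c (x t) (u t))) *\<^sub>R J c (x t) (u t)) (u t)" for t
    have geod: "g c (x t) (DDu t) (J c (x t) (u t)) = 0"
      "\<exists>l. DDu t = l *\<^sub>R u t - (2 * \<delta>\<^sup>2 * g c (x t) (Du t) (J c (x t) (u t))) *\<^sub>R J c (x t) (Du t)"
      "x'' t = F t (x' t)" if t: "t \<in> I'" for t
    proof -
      have "geodesic_at TYPE('e) {(y, p). y \<in> ?V \<and> cometric (g c) y p p = 1} (bs_metric (g c) (J c) \<delta>) q t"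
        using assms(8) c(1) t \<pi>C(1) unfolding bs_geodesic_def unit_cotangent_coords_def q_def I'_def by auto
      note eqs = K.geodesic_equations[OF assms(2) this I' t fst_q u_def[symmetric] x cov(1) cov(2,3)[OF t]]
      show "g c (x t) (DDu t) (J c (x t) (u t)) = 0" by (rule eqs(1))
      show "\<exists>l. DDu t = l *\<^sub>R u t - (2 * \<delta>\<^sup>2 * g c (x t) (Du t) (J c (x t) (u t))) *\<^sub>R J c (x t) (Du t)"
        by (rule eqs(2))
      show "x'' t = F t (x' t)" unfolding F_def by (rule eqs(3))
    qed
    have "t0 \<in> I'" using t0 c by (simp add: I'_def)
    then obtain \<epsilon> where "\<epsilon> > 0" and ball: "ball t0 \<epsilon> \<subseteq> I'" using I' openE by blast
    \<comment> \<open>The set \<open>I'\<close> of times spent in the chart is open but may be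
      disconnected, hence the restriction to a ball around \<open>t0\<close>.\<close>
    have "k i constant_on ball t0 \<epsilon>"
    proof (rule K.frenet_curvatures_locally_constant[where x = x and x' = x' and F = F
          and e = "\<lambda>i t. \<nu> i t c" and r = r])
      fix t assume "t \<in> ball t0 \<epsilon>"
      then have t: "t \<in> I'" using ball by blast
      then have tI: "t \<in> I" "\<gamma> t \<in> fst c" by (auto simp: I'_def)
      have vd: "vector_derivative x (at t) = x' t" using vector_derivative_at[OF x[OF t]] .
      \<comment> \<open>The last conjunct of \<open>frenet_frame\<close> at the time
        \<open>t\<close> and in the chart \<open>c\<close>, rewritten in terms of \<open>x\<close>
        and \<open>x'\<close>.\<close>
      note fr = frenet[THEN conjunct2, THEN conjunct2, THEN conjunct2, THEN bspec, OF tI(1), THEN bspec,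
          OF c(1), THEN mp, OF tI(2), folded x_def, unfolded vd]
      show "x t \<in> ?V" by (rule xV[OF t])
      show "(x has_vector_derivative x' t) (at t)" by (rule x[OF t])
      show "x' t \<noteq> 0" using fr by blast
      show "linear (F t)" unfolding F_def by (rule K.R_linear(1)[OF xV[OF t]])
      show "g c (x t) (F t v) v = 0" for v
        unfolding F_def using K.R_skew[OF xV[OF t], of _ _ v v] K.G_sym[OF xV[OF t], of v] by (smt (verit))
      show "has_cov_deriv (g c) x (\<lambda>s. F s (E s)) (F t E') t" if E: "has_cov_deriv (g c) x E E' t" for E E'
      proof -
        obtain l where "DDu t = l *\<^sub>R u t - (2 * \<delta>\<^sup>2 * g c (x t) (Du t) (J c (x t) (u t))) *\<^sub>R J c (x t) (Du t)"
          using geod(2)[OF t] by blast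
        from K.force_parallel[OF sym[OF xV[OF t]] xV[OF t] x[OF t] cov(1)[OF t] cov(3)[OF t] geod(1)[OF t] this E]
        show ?thesis by (simp add: F_def[abs_def])
      qed
      show "has_cov_deriv (g c) x x' (F t (x' t)) t" using cov(2)[OF t] geod(3)[OF t] by simp
      show "\<nu> 1 t c = x' t /\<^sub>R sqrt (g c (x t) (x' t) (x' t))"
        using fr by blast
      show "g c (x t) (\<nu> i t c) (\<nu> i t c) = 1" if "i \<in> {1..r}" for i
        using fr that by simp
      show "k i t \<ge> 0" if "i \<in> {1..<r}" for i using frenet tI that by blast
      show "k i t > 0" if "i \<in> {1..<r - 1}" for i using frenet tI that by blast
      show "has_cov_deriv (g c) x (\<lambda>t. \<nu> i t c) (sqrt (g c (x t) (x' t) (x' t)) *\<^sub>R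
          ((if i = 1 then 0 else - (k (i - 1) t *\<^sub>R \<nu> (i - 1) t c)) + k i t *\<^sub>R \<nu> (i + 1) t c)) t"
        if "i \<in> {1..<r}" for i
        using fr that by blast
    qed (use i in auto)
    then show ?thesis using \<open>\<epsilon> > 0\<close> by (intro exI[of _ "ball t0 \<epsilon>"]) simp
  qed
  \<comment> \<open>Local constancy gives derivative zero at every time of \<open>I\<close>; since
    \<open>I\<close> is an interval, the local constants coincide across charts.\<close>
  have "(k i has_real_derivative 0) (at t)" if t: "t \<in> I" for t
  proof -
    obtain S a where S: "open S" "t \<in> S" "\<And>s. s \<in> S \<Longrightarrow> k i s = a"
      using local_const[OF t] unfolding constant_on_def by metis
    show ?thesis
      by (rule has_field_derivative_transform_within_open[OF DERIV_const[of a] S(1,2)]) (simp add: S(3))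
  qed
  then show "k i constant_on I"
    using is_interval_connected[OF assms(6)] assms(5)
    by (intro DERIV_zero_connected_constant_on[of I "{}"] DERIV_continuous_on[of I _ "\<lambda>_. 0"])
      (auto intro: has_field_derivative_at_within)
qed

end
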